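(* Let $D=(0,\infty)$. For every $x>0$, the distribution of the first exit time $\tau_D$ of the Cauchy process started at $x$ is given on $t\in(0,\infty)$ by $$\mathbf{P}_x(\tau_D\in dt)=\frac1\pi\,\frac{x}{t^2+x^2}\,\exp\left(\frac1\pi\int_0^\infty\frac{\log\left(\frac tx+w\right)}{1+w^2}\,dw\right)dt.$$
   Context: $(X_t)_{t\ge0}$ is the one-dimensional Cauchy process, with $\mathbf{P}_x(X_t\in dy)=\frac1\pi\frac{t}{t^2+(y-x)^2}\,dy$, where $\mathbf{P}_x$ is the law of the process started at $x$; $\tau_D=\inf\{t\ge0:X_t\notin D\}$. *)

theory Defs
  imports "HOL-Probability.Probability"
begin

text \<open>Density of the law at time \<open>t\<close> of the Cauchy process started at \<open>x\<close>.\<close>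

definition cauchy_density :: "real \<Rightarrow> real \<Rightarrow> real \<Rightarrow> real" where
  "cauchy_density t x y = 1 / pi * (t / (t\<^sup>2 + (y - x)\<^sup>2))"

definition cadlag :: "(real \<Rightarrow> real) \<Rightarrow> bool" where
  "cadlag f \<longleftrightarrow>
     (\<forall>t\<ge>0. (f \<longlongrightarrow> f t) (at_right t)) \<and>
     (\<forall>t>0. \<exists>l. (f \<longlongrightarrow> l) (at_left t))"

text \<open>
  The Levy process with Cauchy increments, under the law \<open>P\<^sub>x\<close>; only the
  times \<open>t \<ge> 0\<close> are relevant.
\<close>

locale cauchy_process = prob_space M
  for M :: "'a measure" and x :: real and X :: "real \<Rightarrow> 'a \<Rightarrow> real" +
  assumes measurable_at: "\<And>t. 0 \<le> t \<Longrightarrow> X t \<in> borel_measurable M"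
    and start: "AE \<omega> in M. X 0 \<omega> = x"
    and indep_increments:
      "\<And>(n::nat) (s :: nat \<Rightarrow> real). 0 \<le> s 0 \<Longrightarrow> (\<And>i. i < n \<Longrightarrow> s i < s (Suc i)) \<Longrightarrow>
         indep_vars (\<lambda>_. borel) (\<lambda>i \<omega>. X (s (Suc i)) \<omega> - X (s i) \<omega>) {..<n}"
    and increment_density:
      "\<And>s t. 0 \<le> s \<Longrightarrow> s < t \<Longrightarrow>
         distributed M lborel (\<lambda>\<omega>. X t \<omega> - X s \<omega>) (\<lambda>y. ennreal (cauchy_density (t - s) 0 y))"
    and cadlag_paths: "AE \<omega> in M. cadlag (\<lambda>t. X t \<omega>)"

text \<open>Extended-real valued: the exit time is \<open>\<infinity>\<close> on paths that never leave \<open>D\<close>.\<close>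

definition exit_time :: "(real \<Rightarrow> 'a \<Rightarrow> real) \<Rightarrow> real set \<Rightarrow> 'a \<Rightarrow> ereal" where
  "exit_time X D \<omega> = (INF t\<in>{t. 0 \<le> t \<and> X t \<omega> \<notin> D}. ereal t)"

text \<open>
  For every start point the marginal laws are the ones given by \<^const>\<open>cauchy_density\<close>.
\<close>

lemma (in cauchy_process) marginal_density:
  assumes "0 < t"
  shows "distributed M lborel (X t) (\<lambda>y. ennreal (cauchy_density t x y))"
proof -
  have meas: "X t \<in> borel_measurable M" using measurable_at assms by simp
  have d: "distr M lborel (\<lambda>\<omega>. X t \<omega> - X 0 \<omega>)
      = density lborel (\<lambda>y. ennreal (cauchy_density t 0 y))"
    using increment_density[of 0 t] assms by (simp add: distributed_def)
  have b0: "(\<lambda>y. ennreal (cauchy_density t z y)) \<in> borel_measurable borel" for z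
    unfolding cauchy_density_def by measurable
  have "distr M lborel (X t) = distr M lborel (\<lambda>\<omega>. x + (X t \<omega> - X 0 \<omega>))"
    using start meas measurable_at[of 0] by (intro distr_cong_AE) auto
  also have "\<dots> = distr (distr M lborel (\<lambda>\<omega>. X t \<omega> - X 0 \<omega>)) lborel ((+) x)"
    using meas measurable_at[of 0] by (subst distr_distr) (auto simp: o_def)
  also have "\<dots> = density lborel (\<lambda>y. ennreal (cauchy_density t x y))"
  proof (rule measure_eqI)
    fix A assume "A \<in> sets (distr (distr M lborel (\<lambda>\<omega>. X t \<omega> - X 0 \<omega>)) lborel ((+) x))"
    then have A [measurable]: "A \<in> sets borel" by simp
    have vA: "(+) x -` A \<in> sets borel"
      using A by (intro measurable_sets_borel[of _ borel]) auto
    have "emeasure (distr (distr M lborel (\<lambda>\<omega>. X t \<omega> - X 0 \<omega>)) lborel ((+) x)) A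
        = (\<integral>\<^sup>+y. ennreal (cauchy_density t 0 y) * indicator ((+) x -` A) y \<partial>lborel)"
      unfolding d using b0[of 0] A vA
      by (subst emeasure_distr) (auto simp: emeasure_density)
    also have "\<dots> = (\<integral>\<^sup>+y. ennreal (cauchy_density t x (x + y)) * indicator A (x + y) \<partial>lborel)"
      by (intro nn_integral_cong) (auto simp: cauchy_density_def indicator_def)
    also have "\<dots> = (\<integral>\<^sup>+y. ennreal (cauchy_density t x y) * indicator A y \<partial>lborel)"
      using b0[of x] nn_integral_real_affine[of "\<lambda>y. ennreal (cauchy_density t x y) * indicator A y" 1 x]
      by simp
    finally show "emeasure (distr (distr M lborel (\<lambda>\<omega>. X t \<omega> - X 0 \<omega>)) lborel ((+) x)) A
        = emeasure (density lborel (\<lambda>y. ennreal (cauchy_density t x y))) A"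
      using b0[of x] A by (simp add: emeasure_density)
  qed simp
  finally show ?thesis
    using meas b0[of x] by (simp add: distributed_def)
qed

end

theory Submission
  imports Defs "HOL-Complex_Analysis.Complex_Analysis" "HOL-Real_Asymp.Real_Asymp"
begin

text \<open>
  Write \<open>Z\<^sub>T\<close> for the supremum of \<open>X\<^sub>0 - X\<^sub>t\<close> over \<open>0 \<le> t \<le> T\<close>, divided by \<open>T\<close>. A path started at \<open>x\<close>
  has left the half-line by time \<open>T\<close> if \<open>Z\<^sub>T > x / T\<close>, and only if \<open>Z\<^sub>T \<ge> x / T\<close>. The Cauchy
  process is self-similar, so the law \<open>N\<close> of \<open>Z\<^sub>T\<close> does not depend on \<open>T\<close>. If \<open>N\<close> has a density on
  \<open>(0, \<infinity>)\<close>, then the event \<open>{\<tau> \<le> T}\<close> differs from \<open>{Z\<^sub>T \<ge> x / T}\<close> by a null set, which gives both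
  the measurability of \<open>\<tau>\<close> in the completion and its distribution function. It remains to compute \<open>N\<close>.

  Spitzer's identity (\<open>walk_max_law_Spitzer\<close>) for the walk \<open>X\<^sub>0 - X\<^bsub>iT/n\<^esub>\<close> has a scaling limit: if
  \<open>U\<close> is uniform on \<open>[0, 1]\<close>, \<open>C\<close> is a standard Cauchy variable, \<open>Z\<close> has law \<open>N\<close> and the three are
  independent, then \<open>U C\<^sup>+ + (1 - U) Z\<close> has law \<open>N\<close> again. Testing with \<open>v \<mapsto> 1 / (p + v)\<^sup>2\<close> and using
  Feynman's formula \<open>\<integral>\<^sub>0\<^sup>1 du / (p + u a + (1 - u) b)\<^sup>2 = 1 / ((p + a) (p + b))\<close>, one obtains
  \<open>\<alpha>' = - \<beta> \<alpha>\<close> for \<open>\<alpha>(p) = E[1 / (p + Z)]\<close> and \<open>\<beta>(p) = E[1 / (p + C\<^sup>+)]\<close>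
  (\<open>stable_walk_limit_identity\<close>). The function \<open>\<beta>\<close> is elementary, and \<open>p \<alpha>(p)\<close> tends to \<open>1\<close> at infinity.
  Hence \<open>\<alpha>(p) = p\<^bsup>-1/2\<^esup> exp(- L(p) / \<pi>)\<close>, where \<open>L\<close> is the integral in the theorem
  (\<open>stieltjes_real_closed_form\<close>).

  To pass from the Stieltjes transform \<open>\<alpha>\<close> to the density, extend the differential equation to the
  plane cut along \<open>(-\<infinity>, 0]\<close>. For \<open>Im z > 0\<close> the logarithms in \<open>\<beta>(z)\<close> and \<open>\<beta>(- z)\<close> differ by
  \<open>\<i> \<pi>\<close>, so \<open>\<beta>(z) - \<beta>(- z)\<close> is rational and the equation for \<open>\<alpha>(z) \<alpha>(- z)\<close> can be solved explicitly:
  \<open>\<alpha>(z) \<alpha>(- z) z (z + \<i>) = - 1\<close> (\<open>stieltjes_reflection\<close>). This expresses the boundary values of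
  \<open>\<alpha>\<close> on the cut by its values on the positive axis. Stieltjes inversion with the Poisson kernel then gives \<open>N\<close> the
  density \<open>1 / (\<pi> y (1 + y\<^sup>2) \<alpha>(y))\<close> (\<open>emeasure_Icc\<close>), and the substitution \<open>y = x / t\<close> turns it into the
  density of the theorem.
\<close>

section \<open>Spitzer's identity for the maximum of a random walk\<close>

text \<open>
  The law of \<open>max(0, S\<^sub>1, \<dots>, S\<^sub>n)\<close> for a walk with step law \<open>F\<close>: it is \<open>(x + m)\<^sup>+\<close>,
  where \<open>x\<close> is the first step and \<open>m\<close> the maximum of the walk that starts after it.
\<close>
primrec walk_max_law :: "real measure \<Rightarrow> nat \<Rightarrow> real measure" where
  "walk_max_law F 0 = return borel 0"
| "walk_max_law F (Suc n) = distr (F \<Otimes>\<^sub>M walk_max_law F n) borel (\<lambda>(x, m). max 0 (x + m))"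

lemma sets_walk_max_law [simp, measurable_cong]: "sets (walk_max_law F n) = sets borel"
  by (cases n) auto

lemma prob_space_walk_max_law:
  assumes "prob_space F" and [measurable_cong]: "sets F = sets borel"
  shows "prob_space (walk_max_law F n)"
proof (induction n)
  case 0
  show ?case by (simp add: prob_space_return)
next
  case (Suc n)
  interpret F: prob_space F by fact
  interpret A: prob_space "walk_max_law F n" by (rule Suc)
  interpret pair_prob_space F "walk_max_law F n" ..
  show ?case by (auto intro!: prob_space_distr)
qed

lemma nn_integral_walk_max_law_Suc:
  assumes "prob_space F" and [measurable_cong]: "sets F = sets borel"
    and [measurable]: "f \<in> borel_measurable borel"
  shows "(\<integral>\<^sup>+m. f m \<partial>walk_max_law F (Suc n))
    = (\<integral>\<^sup>+x. \<integral>\<^sup>+m. f (max 0 (x + m)) \<partial>walk_max_law F n \<partial>F)"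
proof -
  interpret F: prob_space F by fact
  interpret A: prob_space "walk_max_law F n" by (rule prob_space_walk_max_law) fact+
  show ?thesis
    by (simp add: nn_integral_distr A.nn_integral_fst[symmetric])
qed

text \<open>
  Spitzer's identity, written for coefficients instead of generating functions; \<open>F k\<close> is the law of
  the \<open>k\<close>-th partial sum. It rests on the pointwise fact that the multisets
  \<open>{s\<^sup>+ + v\<^sup>+, (s + v)\<^sup>+}\<close> and \<open>{(s\<^sup>+ + v)\<^sup>+, (s + v\<^sup>+)\<^sup>+}\<close> agree. Applied with \<open>v\<close> the first step
  plus the maximum of the walk after it, it relates each term of the identity for \<open>n + 1\<close> to the corresponding term for
  \<open>n\<close>, up to remainders that telescope. Boundedness of \<open>f\<close> makes the remainders
  finite, so that they cancel.
\<close>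
lemma walk_max_law_Spitzer:
  fixes F :: "nat \<Rightarrow> real measure" and f :: "real \<Rightarrow> ennreal"
  assumes prob: "\<And>k. prob_space (F k)"
    and sets_F [measurable_cong]: "\<And>k. sets (F k) = sets borel"
    and conv: "\<And>k. 1 \<le> k \<Longrightarrow> F (Suc k) = distr (F k \<Otimes>\<^sub>M F 1) borel (\<lambda>(s, x). s + x)"
    and "f \<in> borel_measurable borel" and "\<And>v. f v \<le> c" and c: "c < \<infinity>"
  shows "of_nat n * (\<integral>\<^sup>+m. f m \<partial>walk_max_law (F 1) n)
    = (\<Sum>k=1..n. \<integral>\<^sup>+s. \<integral>\<^sup>+m. f (max 0 s + m) \<partial>walk_max_law (F 1) (n - k) \<partial>F k)"
  using assms(4,5)
proof (induction n arbitrary: f)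
  case 0
  show ?case by simp
next
  case (Suc n)
  note [measurable] = Suc.prems(1)
  note le_c = Suc.prems(2)
  define B where "B = F 1"
  define A where "A = walk_max_law B"
  have prob_B: "prob_space B" and sets_B [measurable_cong]: "sets B = sets borel"
    unfolding B_def by (rule prob sets_F)+
  have sets_A [measurable_cong]: "sets (A j) = sets borel" for j
    unfolding A_def by simp
  interpret F: prob_space "F k" for k by (rule prob)
  interpret B: prob_space B by (rule prob_B)
  interpret A: prob_space "A k" for k unfolding A_def by (rule prob_space_walk_max_law[OF prob_B sets_B])
  interpret FB: pair_prob_space "F i" B for i ..
  note conv = conv[folded B_def]
  note IH = Suc.IH[folded B_def, folded A_def]
  (* T k is the k-th term of the claim, R k the telescoping remainder, and U x k the k-th term of
     the induction hypothesis for the function v \<mapsto> f (max 0 (x + v)). *)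
  define T where "T k = (\<integral>\<^sup>+s. \<integral>\<^sup>+m. f (max 0 s + m) \<partial>A (Suc n - k) \<partial>F k)" for k
  define R where "R k = (\<integral>\<^sup>+s. \<integral>\<^sup>+m. f (max 0 (s + m)) \<partial>A (Suc n - k) \<partial>F k)" for k
  define U where "U x k = (\<integral>\<^sup>+s. \<integral>\<^sup>+m. f (max 0 (x + (max 0 s + m))) \<partial>A (n - k) \<partial>F k)" for x k
  have R1: "R 1 = (\<integral>\<^sup>+m. f m \<partial>A (Suc n))"
    unfolding R_def by (subst nn_integral_walk_max_law_Suc[OF prob_B sets_B, folded A_def]) (simp_all add: B_def)
  have Rfin: "R k < \<infinity>" for k
  proof -
    have "R k \<le> (\<integral>\<^sup>+s. \<integral>\<^sup>+m. c \<partial>A (Suc n - k) \<partial>F k)"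
      unfolding R_def by (intro nn_integral_mono le_c)
    also have "\<dots> = c" by (simp add: A.emeasure_space_1[simplified] F.emeasure_space_1)
    finally show ?thesis using c by simp
  qed
  have Rne: "(\<Sum>k=1..n. R k) \<noteq> \<infinity>"
    using Rfin by (simp add: less_top)
  have T_last: "T (Suc n) = R (Suc n)"
    unfolding T_def R_def by (simp add: A_def nn_integral_return)
  have step: "T k + R (Suc k) = (\<integral>\<^sup>+x. U x k \<partial>B) + R k" if k: "1 \<le> k" "k \<le> n" for k
  proof -
    have [simp]: "Suc n - k = Suc (n - k)" using k by simp
    have T: "T k = (\<integral>\<^sup>+s. \<integral>\<^sup>+x. \<integral>\<^sup>+m. f (max 0 s + max 0 (x + m)) \<partial>A (n - k) \<partial>B \<partial>F k)"
      unfolding T_def by (simp only: \<open>Suc n - k = _\<close>)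
        (subst nn_integral_walk_max_law_Suc[OF prob_B sets_B, folded A_def]; simp)
    have R: "R k = (\<integral>\<^sup>+s. \<integral>\<^sup>+x. \<integral>\<^sup>+m. f (max 0 (s + max 0 (x + m))) \<partial>A (n - k) \<partial>B \<partial>F k)"
      unfolding R_def by (simp only: \<open>Suc n - k = _\<close>)
        (subst nn_integral_walk_max_law_Suc[OF prob_B sets_B, folded A_def]; simp)
    have R': "R (Suc k) = (\<integral>\<^sup>+s. \<integral>\<^sup>+x. \<integral>\<^sup>+m. f (max 0 (s + x + m)) \<partial>A (n - k) \<partial>B \<partial>F k)"
      proof -
      define g where "g s = (\<integral>\<^sup>+m. f (max 0 (s + m)) \<partial>A (n - k))" for s
      have g [measurable]: "g \<in> borel_measurable borel" unfolding g_def by measurable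
      have "R (Suc k) = (\<integral>\<^sup>+p. g (fst p + snd p) \<partial>(F k \<Otimes>\<^sub>M B))"
        unfolding R_def conv[OF k(1)] diff_Suc_Suc g_def[symmetric] case_prod_beta
        by (rule nn_integral_distr) measurable
      also have "\<dots> = (\<integral>\<^sup>+s. \<integral>\<^sup>+x. g (s + x) \<partial>B \<partial>F k)"
        by (subst B.nn_integral_fst[symmetric]) simp_all
      also have "\<dots> = (\<integral>\<^sup>+s. \<integral>\<^sup>+x. \<integral>\<^sup>+m. f (max 0 (s + x + m)) \<partial>A (n - k) \<partial>B \<partial>F k)"
        unfolding g_def ..
      finally show ?thesis .
    qed
    have U: "(\<integral>\<^sup>+x. U x k \<partial>B)
        = (\<integral>\<^sup>+s. \<integral>\<^sup>+x. \<integral>\<^sup>+m. f (max 0 (x + (max 0 s + m))) \<partial>A (n - k) \<partial>B \<partial>F k)"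
      unfolding U_def by (rule FB.Fubini') measurable
    have pt: "f (max 0 s + max 0 (x + m)) + f (max 0 (s + x + m))
        = f (max 0 (x + (max 0 s + m))) + f (max 0 (s + max 0 (x + m)))" for s x m :: real
      by (cases "0 \<le> s"; cases "0 \<le> x + m") (simp_all add: max_def algebra_simps add.commute)
    show ?thesis
      unfolding T R R' U by (simp add: nn_integral_add[symmetric] pt)
  qed
  have sum_U: "(\<Sum>k=1..n. U x k) = of_nat n * (\<integral>\<^sup>+m. f (max 0 (x + m)) \<partial>A n)" for x
    unfolding U_def by (rule IH[symmetric]) (auto intro: le_c)
  have U_meas: "(\<lambda>x. U x k) \<in> borel_measurable (B)" for k
    unfolding U_def by measurable
  have sumU: "(\<Sum>k=1..n. \<integral>\<^sup>+x. U x k \<partial>B) = of_nat n * R 1"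
  proof -
    have "(\<Sum>k=1..n. \<integral>\<^sup>+x. U x k \<partial>B) = (\<integral>\<^sup>+x. (\<Sum>k=1..n. U x k) \<partial>B)"
      by (rule nn_integral_sum[symmetric]) (rule U_meas)
    also have "\<dots> = (\<integral>\<^sup>+x. of_nat n * (\<integral>\<^sup>+m. f (max 0 (x + m)) \<partial>A n) \<partial>B)"
      by (simp only: sum_U)
    also have "\<dots> = of_nat n * (\<integral>\<^sup>+x. (\<integral>\<^sup>+m. f (max 0 (x + m)) \<partial>A n) \<partial>B)"
      by (rule nn_integral_cmult) measurable
    also have "\<dots> = of_nat n * R 1"
      unfolding R_def B_def by simp
    finally show ?thesis .
  qed
  have Rsum: "R 1 + (\<Sum>k=1..n. R (Suc k)) = (\<Sum>k=1..n. R k) + R (Suc n)"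
  proof -
    have "R 1 + (\<Sum>k=1..n. R (Suc k)) = (\<Sum>k=1..Suc n. R k)"
      by (subst sum.atLeast_Suc_atMost[where m=1], simp, subst sum.shift_bounds_cl_Suc_ivl) simp
    then show ?thesis by simp
  qed
  have "(\<Sum>k=1..n. R k) + (\<Sum>k=1..Suc n. T k) = R 1 + (\<Sum>k=1..n. T k + R (Suc k))"
    using Rsum by (simp add: sum.distrib T_last ac_simps)
  also have "\<dots> = R 1 + (of_nat n * R 1 + (\<Sum>k=1..n. R k))"
    using step sumU by (simp add: sum.distrib)
  also have "\<dots> = (\<Sum>k=1..n. R k) + of_nat (Suc n) * R 1"
    by (simp add: algebra_simps)
  finally have "(\<Sum>k=1..Suc n. T k) = of_nat (Suc n) * R 1"
    using Rne by (simp add: ennreal_add_left_cancel del: sum.cl_ivl_Suc of_nat_Suc)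
  then show ?case using R1 unfolding T_def A_def B_def by simp
qed

section \<open>The scaling limit of Spitzer's identity for a stable walk\<close>

text \<open>
  The antiderivative \<open>u / ((p + u a + (1 - u) b) (p + b))\<close> covers the case \<open>a = b\<close> as well.
\<close>
lemma nn_integral_Feynman:
  assumes p: "0 < p" and a: "0 \<le> a" and b: "0 \<le> b"
  shows "(\<integral>\<^sup>+u. ennreal (1 / (p + (u * a + (1 - u) * b))\<^sup>2) * indicator {0..1} u \<partial>lborel)
    = ennreal (1 / (p + a)) * ennreal (1 / (p + b))"
proof -
  have pos: "0 < p + (u * a + (1 - u) * b)" if "u \<in> {0..1}" for u
    using p a b that by (auto intro!: add_pos_nonneg)
  have "(\<integral>\<^sup>+u. ennreal (1 / (p + (u * a + (1 - u) * b))\<^sup>2) * indicator {0..1} u \<partial>lborel)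
      = ennreal (1 / (p + (1 * a + (1 - 1) * b)) / (p + b) - 0 / (p + (0 * a + (1 - 0) * b)) / (p + b))"
  proof (rule nn_integral_FTC_Icc)
    fix u :: real assume u: "u \<in> {0..1}"
    let ?D = "p + (u * a + (1 - u) * b)"
    have "((\<lambda>u. u / (p + (u * a + (1 - u) * b)) / (p + b)) has_real_derivative
        (1 * ?D - u * (a - b)) / (?D * ?D) / (p + b)) (at u)"
      using pos[OF u] by (intro DERIV_cdivide DERIV_divide) (auto intro!: derivative_eq_intros)
    moreover have "1 * ?D - u * (a - b) = p + b" by (simp add: algebra_simps)
    moreover have "(p + b) / (?D * ?D) / (p + b) = 1 / ?D\<^sup>2"
      using p b by (simp add: power2_eq_square)
    ultimately show "((\<lambda>u. u / (p + (u * a + (1 - u) * b)) / (p + b)) has_real_derivative 1 / ?D\<^sup>2) (at u)"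
      by (simp only:)
  qed (auto simp: zero_le_divide_iff)
  also have "\<dots> = ennreal (1 / (p + a)) * ennreal (1 / (p + b))"
    using p a b by (simp add: ennreal_mult[symmetric])
  finally show ?thesis .
qed

text \<open>
  Writing a sum as the integral of a step function replaces Riemann sums by dominated convergence.
\<close>
lemma nn_integral_step_function:
  fixes c :: "nat \<Rightarrow> ennreal"
  assumes n: "0 < n"
  shows "of_nat n * (\<integral>\<^sup>+u. (\<Sum>k=1..n. c k * indicator {(real k - 1) / real n<..real k / real n} u) \<partial>lborel) = (\<Sum>k=1..n. c k)"
proof -
  have "(\<integral>\<^sup>+u. (\<Sum>k=1..n. c k * indicator {(real k - 1) / real n<..real k / real n} u) \<partial>lborel)
      = (\<Sum>k=1..n. c k * ennreal (1 / real n))"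
    using n by (subst nn_integral_sum) (auto simp: nn_integral_cmult divide_right_mono diff_divide_distrib[symmetric])
  also have "of_nat n * \<dots> = (\<Sum>k=1..n. c k)"
  proof -
    have "of_nat n * ennreal (1 / real n) = 1"
      using n by (simp add: ennreal_of_nat_eq_real_of_nat ennreal_mult[symmetric])
    then have "of_nat n * (c k * ennreal (1 / real n)) = c k" for k
      by (metis mult.commute mult.left_commute mult_1)
    then show ?thesis by (simp add: sum_distrib_left)
  qed
  finally show ?thesis .
qed

lemma step_function_eq:
  fixes c :: "nat \<Rightarrow> ennreal"
  assumes n: "0 < n" and u: "0 < u" "u \<le> 1"
  shows "(\<Sum>k=1..n. c k * indicator {(real k - 1) / real n<..real k / real n} u) = c (nat \<lceil>real n * u\<rceil>)"
    and "nat \<lceil>real n * u\<rceil> \<le> n"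
proof -
  let ?k = "nat \<lceil>real n * u\<rceil>"
  have pos: "0 < real n * u" using n u by simp
  then have k1: "1 \<le> ?k" by linarith
  have "real n * u \<le> real n" using n u by simp
  then show kn: "?k \<le> n" by linarith
  have iff: "u \<in> {(real k - 1) / real n<..real k / real n} \<longleftrightarrow> k = ?k" for k
  proof -
    have "u \<in> {(real k - 1) / real n<..real k / real n} \<longleftrightarrow> real k - 1 < real n * u \<and> real n * u \<le> real k"
      using n by (auto simp: divide_less_eq le_divide_eq mult.commute)
    also have "\<dots> \<longleftrightarrow> k = ?k" using pos by linarith
    finally show ?thesis .
  qed
  have "(\<Sum>k=1..n. c k * indicator {(real k - 1) / real n<..real k / real n} u)
      = (\<Sum>k=1..n. if k = ?k then c k else 0)"
    by (intro sum.cong) (auto simp: indicator_def iff simp del: greaterThanAtMost_iff)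
  also have "\<dots> = c ?k" using k1 kn by (simp add: sum.delta)
  finally show "(\<Sum>k=1..n. c k * indicator {(real k - 1) / real n<..real k / real n} u) = c ?k" .
qed

lemma ceiling_ratio_tendsto:
  assumes u: "0 < u"
  shows "(\<lambda>n. real (nat \<lceil>real (Suc n) * u\<rceil>) / real (Suc n)) \<longlonglongrightarrow> u"
proof (rule tendsto_sandwich)
  show "\<forall>\<^sub>F n in sequentially. u \<le> real (nat \<lceil>real (Suc n) * u\<rceil>) / real (Suc n)"
    by (rule always_eventually) (auto simp: le_divide_eq mult.commute simp del: of_nat_Suc, linarith)
  show "\<forall>\<^sub>F n in sequentially. real (nat \<lceil>real (Suc n) * u\<rceil>) / real (Suc n) \<le> u + inverse (real (Suc n))"
  proof (rule always_eventually, rule allI)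
    fix n
    have "0 \<le> real (Suc n) * u" using u by simp
    then have "real (nat \<lceil>real (Suc n) * u\<rceil>) \<le> real (Suc n) * u + 1" by linarith
    then have "real (nat \<lceil>real (Suc n) * u\<rceil>) / real (Suc n) \<le> (real (Suc n) * u + 1) / real (Suc n)"
      by (intro divide_right_mono) auto
    also have "\<dots> = u + inverse (real (Suc n))"
      by (simp add: add_divide_distrib inverse_eq_divide del: of_nat_Suc)
    finally show "real (nat \<lceil>real (Suc n) * u\<rceil>) / real (Suc n) \<le> u + inverse (real (Suc n))" .
  qed
  show "(\<lambda>n. u + inverse (real (Suc n))) \<longlonglongrightarrow> u"
    using tendsto_add[OF tendsto_const[of u] LIMSEQ_inverse_real_of_nat] by simp
qed simp

lemma filterlim_real_Suc: "filterlim (\<lambda>n. real (Suc n)) at_top sequentially"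
  by (rule filterlim_compose[OF filterlim_real_sequentially filterlim_Suc])

lemma filterlim_complement_ceiling:
  assumes u: "0 < u" "u < 1"
  shows "filterlim (\<lambda>n. Suc n - nat \<lceil>real (Suc n) * u\<rceil>) at_top sequentially"
proof -
  let ?k = "\<lambda>n. nat \<lceil>real (Suc n) * u\<rceil>"
  have "(\<lambda>n. 1 - real (?k n) / real (Suc n)) \<longlonglongrightarrow> 1 - u"
    by (intro tendsto_intros ceiling_ratio_tendsto u)
  then have "filterlim (\<lambda>n. (1 - real (?k n) / real (Suc n)) * real (Suc n)) at_top sequentially"
    by (rule filterlim_tendsto_pos_mult_at_top[OF _ _ filterlim_real_Suc]) (use u in simp)
  moreover have "(1 - real (?k n) / real (Suc n)) * real (Suc n) = real (Suc n - ?k n)" for n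
  proof -
    have "?k n \<le> Suc n" using step_function_eq(2)[of "Suc n" u] u by simp
    then show ?thesis by (simp add: left_diff_distrib of_nat_diff del: of_nat_Suc)
  qed
  ultimately show ?thesis by (simp add: filterlim_sequentially_iff_filterlim_real)
qed

text \<open>
  By Spitzer's identity and the scaling of the partial sums, \<open>Zn n\<close> has the law of
  \<open>(k / n) s\<^sup>+ + (1 - k / n) Zn (n - k)\<close> with \<open>k\<close> uniform on \<open>{1..n}\<close>. In the limit
  \<open>Z\<close> has the law of \<open>u s\<^sup>+ + (1 - u) Z\<close> with \<open>u\<close> uniform on \<open>[0, 1]\<close>, and for the test function
  \<open>1 / (p + v)\<^sup>2\<close> the integral over \<open>u\<close> factorises by Feynman's formula. The left-hand side is
  minus the derivative in \<open>p\<close> of the last factor.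
\<close>
lemma stable_walk_limit_identity:
  fixes F :: "nat \<Rightarrow> real measure" and Zn :: "nat \<Rightarrow> 'a \<Rightarrow> real"
  assumes prob: "\<And>k. prob_space (F k)"
    and sets_F [measurable_cong]: "\<And>k. sets (F k) = sets borel"
    and conv: "\<And>k. 1 \<le> k \<Longrightarrow> F (Suc k) = distr (F k \<Otimes>\<^sub>M F 1) borel (\<lambda>(s, x). s + x)"
    and scale: "\<And>k. 1 \<le> k \<Longrightarrow> F k = distr (F 1) borel (\<lambda>s. real k * s)"
    and M: "prob_space M"
    and Zn [measurable]: "\<And>n. Zn n \<in> borel_measurable M"
    and Z [measurable]: "Z \<in> borel_measurable M"
    and law: "\<And>n. distr M borel (\<lambda>\<omega>. real n * Zn n \<omega>) = walk_max_law (F 1) n"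
    and lim: "AE \<omega> in M. (\<lambda>n. Zn n \<omega>) \<longlonglongrightarrow> Z \<omega>"
    and Z0: "AE \<omega> in M. 0 \<le> Z \<omega>"
    and p: "0 < p"
  shows "(\<integral>\<^sup>+\<omega>. ennreal (1 / (p + Z \<omega>)\<^sup>2) \<partial>M)
    = (\<integral>\<^sup>+s. ennreal (1 / (p + max 0 s)) \<partial>F 1) * (\<integral>\<^sup>+\<omega>. ennreal (1 / (p + Z \<omega>)) \<partial>M)"
proof -
  define B where "B = F 1"
  have prob_B: "prob_space B" and sets_B [measurable_cong]: "sets B = sets borel"
    unfolding B_def by (rule prob sets_F)+
  interpret M: prob_space M by (rule M)
  interpret B: prob_space B by (rule prob_B)
  interpret A: prob_space "walk_max_law B k" for k by (rule prob_space_walk_max_law[OF prob_B sets_B])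
  interpret lB: pair_sigma_finite B lborel ..
  interpret lM: pair_sigma_finite M lborel ..
  define \<phi> where "\<phi> v = ennreal (1 / (p + max 0 v)\<^sup>2)" for v
  have \<phi>_meas [measurable]: "\<phi> \<in> borel_measurable borel" unfolding \<phi>_def by measurable
  have \<phi>_le: "\<phi> v \<le> ennreal (1 / p\<^sup>2)" for v
    unfolding \<phi>_def using p by (intro ennreal_leI frac_le power_mono) auto
  have \<phi>_lim: "(\<lambda>n. \<phi> (g n)) \<longlonglongrightarrow> \<phi> l" if "g \<longlonglongrightarrow> l" for g :: "nat \<Rightarrow> real" and l
  proof -
    have "(p + max 0 l)\<^sup>2 \<noteq> 0" using p by (simp add: add_pos_nonneg)
    then show ?thesis
      unfolding \<phi>_def by (intro tendsto_ennrealI tendsto_divide tendsto_const tendsto_power tendsto_add tendsto_max that)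
  qed
  define c where "c n k = (\<integral>\<^sup>+s. \<integral>\<^sup>+\<omega>. \<phi> (real k / real n * max 0 s + real (n - k) / real n * Zn (n - k) \<omega>) \<partial>M \<partial>B)" for n k
  define S where "S n u = (\<Sum>k=1..n. c n k * indicator {(real k - 1) / real n<..real k / real n} u)" for n u
  define C where "C u = (\<integral>\<^sup>+s. \<integral>\<^sup>+\<omega>. \<phi> (u * max 0 s + (1 - u) * Z \<omega>) \<partial>M \<partial>B)" for u
  have C_meas [measurable]: "C \<in> borel_measurable borel" unfolding C_def by measurable
  have c_le: "c n k \<le> ennreal (1 / p\<^sup>2)" for n k
  proof -
    have "c n k \<le> (\<integral>\<^sup>+s. \<integral>\<^sup>+\<omega>. ennreal (1 / p\<^sup>2) \<partial>M \<partial>B)"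
      unfolding c_def by (intro nn_integral_mono \<phi>_le)
    then show ?thesis by (simp add: M.emeasure_space_1 B.emeasure_space_1)
  qed
  have discrete: "(\<integral>\<^sup>+\<omega>. \<phi> (Zn n \<omega>) \<partial>M) = (\<integral>\<^sup>+u. S n u \<partial>lborel)" if n: "0 < n" for n
  proof -
    have push: "(\<integral>\<^sup>+m. g m \<partial>walk_max_law B j) = (\<integral>\<^sup>+\<omega>. g (real j * Zn j \<omega>) \<partial>M)"
      if "g \<in> borel_measurable borel" for g j
      unfolding B_def law[symmetric] using that by (subst nn_integral_distr) auto
    have "of_nat n * (\<integral>\<^sup>+\<omega>. \<phi> (Zn n \<omega>) \<partial>M) = of_nat n * (\<integral>\<^sup>+m. \<phi> (m / real n) \<partial>walk_max_law B n)"
      using n by (subst push) auto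
    also have "\<dots> = (\<Sum>k=1..n. \<integral>\<^sup>+s. \<integral>\<^sup>+m. \<phi> ((max 0 s + m) / real n) \<partial>walk_max_law B (n - k) \<partial>F k)"
      unfolding B_def by (rule walk_max_law_Spitzer[OF prob sets_F conv, where c="ennreal (1 / p\<^sup>2)"]) (auto intro: \<phi>_le)
    also have "\<dots> = (\<Sum>k=1..n. c n k)"
    proof (rule sum.cong[OF refl])
      fix k assume k: "k \<in> {1..n}"
      then have k1: "1 \<le> k" by simp
      have "(\<integral>\<^sup>+s. \<integral>\<^sup>+m. \<phi> ((max 0 s + m) / real n) \<partial>walk_max_law B (n - k) \<partial>F k)
          = (\<integral>\<^sup>+s. \<integral>\<^sup>+m. \<phi> ((max 0 (real k * s) + m) / real n) \<partial>walk_max_law B (n - k) \<partial>B)"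
        unfolding scale[OF k1] B_def[symmetric] by (rule nn_integral_distr) measurable
      also have "\<dots> = (\<integral>\<^sup>+s. \<integral>\<^sup>+\<omega>. \<phi> ((max 0 (real k * s) + real (n - k) * Zn (n - k) \<omega>) / real n) \<partial>M \<partial>B)"
        by (intro nn_integral_cong push) measurable
      also have "\<dots> = c n k"
        unfolding c_def
      proof (intro nn_integral_cong arg_cong[of _ _ \<phi>])
        fix s \<omega>
        have "max 0 (real k * s) = real k * max 0 s"
          by (auto simp: max_def zero_le_mult_iff mult_le_0_iff)
        then show "(max 0 (real k * s) + real (n - k) * Zn (n - k) \<omega>) / real n
            = real k / real n * max 0 s + real (n - k) / real n * Zn (n - k) \<omega>"
          by (simp add: add_divide_distrib)
      qed
      finally show "(\<integral>\<^sup>+s. \<integral>\<^sup>+m. \<phi> ((max 0 s + m) / real n) \<partial>walk_max_law B (n - k) \<partial>F k) = c n k" .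
    qed
    also have "\<dots> = of_nat n * (\<integral>\<^sup>+u. S n u \<partial>lborel)"
      unfolding S_def by (rule nn_integral_step_function[OF n, symmetric])
    finally show ?thesis
      using n by (subst (asm) ennreal_mult_cancel_left) (auto simp: ennreal_of_nat_neq_top)
  qed
  (* For fixed u the index k = \<lceil>(n + 1) u\<rceil> satisfies k / (n + 1) \<rightarrow> u and n + 1 - k \<rightarrow> \<infinity>. *)
  have lim_u: "(\<lambda>n. S (Suc n) u) \<longlonglongrightarrow> C u" if u: "0 < u" "u < 1" for u
  proof -
    let ?k = "\<lambda>n. nat \<lceil>real (Suc n) * u\<rceil>"
    have S_eq: "S (Suc n) u = c (Suc n) (?k n)" for n
      unfolding S_def by (rule step_function_eq(1)) (use u in auto)
    have ratio: "(\<lambda>n. real (?k n) / real (Suc n)) \<longlonglongrightarrow> u" by (rule ceiling_ratio_tendsto[OF u(1)])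
    have ratio': "(\<lambda>n. real (Suc n - ?k n) / real (Suc n)) \<longlonglongrightarrow> 1 - u"
    proof -
      have "real (Suc n - ?k n) / real (Suc n) = 1 - real (?k n) / real (Suc n)" for n
        using step_function_eq(2)[of "Suc n" u] u
        by (simp add: of_nat_diff diff_divide_distrib del: of_nat_Suc)
      then show ?thesis using tendsto_diff[OF tendsto_const[of 1] ratio] by simp
    qed
    show ?thesis unfolding S_eq c_def C_def
    proof (rule nn_integral_dominated_convergence[where w="\<lambda>_. ennreal (1 / p\<^sup>2)"])
      show "AE s in B. (\<lambda>n. \<integral>\<^sup>+\<omega>. \<phi> (real (?k n) / real (Suc n) * max 0 s
            + real (Suc n - ?k n) / real (Suc n) * Zn (Suc n - ?k n) \<omega>) \<partial>M)
          \<longlonglongrightarrow> (\<integral>\<^sup>+\<omega>. \<phi> (u * max 0 s + (1 - u) * Z \<omega>) \<partial>M)"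
      proof (rule AE_I2)
        fix s
        show "(\<lambda>n. \<integral>\<^sup>+\<omega>. \<phi> (real (?k n) / real (Suc n) * max 0 s
            + real (Suc n - ?k n) / real (Suc n) * Zn (Suc n - ?k n) \<omega>) \<partial>M)
          \<longlonglongrightarrow> (\<integral>\<^sup>+\<omega>. \<phi> (u * max 0 s + (1 - u) * Z \<omega>) \<partial>M)"
        proof (rule nn_integral_dominated_convergence[where w="\<lambda>_. ennreal (1 / p\<^sup>2)"])
          show "AE \<omega> in M. (\<lambda>n. \<phi> (real (?k n) / real (Suc n) * max 0 s
              + real (Suc n - ?k n) / real (Suc n) * Zn (Suc n - ?k n) \<omega>)) \<longlonglongrightarrow> \<phi> (u * max 0 s + (1 - u) * Z \<omega>)"
            using lim
          proof eventually_elim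
            case (elim \<omega>)
            have "(\<lambda>n. Zn (Suc n - ?k n) \<omega>) \<longlonglongrightarrow> Z \<omega>"
              by (rule filterlim_compose[OF elim filterlim_complement_ceiling[OF u]])
            then show ?case
              by (intro \<phi>_lim tendsto_add tendsto_mult tendsto_const ratio ratio')
          qed
        qed (measurable, auto intro!: \<phi>_le simp: M.emeasure_space_1)
      qed
      show "AE s in B. (\<integral>\<^sup>+\<omega>. \<phi> (real (?k n) / real (Suc n) * max 0 s
            + real (Suc n - ?k n) / real (Suc n) * Zn (Suc n - ?k n) \<omega>) \<partial>M) \<le> ennreal (1 / p\<^sup>2)" for n
      proof (rule AE_I2)
        fix s
        have "(\<integral>\<^sup>+\<omega>. \<phi> (real (?k n) / real (Suc n) * max 0 s
            + real (Suc n - ?k n) / real (Suc n) * Zn (Suc n - ?k n) \<omega>) \<partial>M) \<le> (\<integral>\<^sup>+\<omega>. ennreal (1 / p\<^sup>2) \<partial>M)"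
          by (intro nn_integral_mono \<phi>_le)
        then show "(\<integral>\<^sup>+\<omega>. \<phi> (real (?k n) / real (Suc n) * max 0 s
            + real (Suc n - ?k n) / real (Suc n) * Zn (Suc n - ?k n) \<omega>) \<partial>M) \<le> ennreal (1 / p\<^sup>2)"
          by (simp add: M.emeasure_space_1)
      qed
    qed (measurable, simp add: B.emeasure_space_1)
  qed
  have S_out: "S n u = 0" if "u \<notin> {0..1}" "0 < n" for n u
  proof -
    have "u \<notin> {(real k - 1) / real n<..real k / real n}" if "k \<in> {1..n}" for k
    proof -
      have "0 \<le> (real k - 1) / real n" "real k / real n \<le> 1"
        using that \<open>0 < n\<close> by auto
      with \<open>u \<notin> {0..1}\<close> show ?thesis by auto
    qed
    then show ?thesis unfolding S_def by (intro sum.neutral) auto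
  qed
  have S_le: "S n u \<le> ennreal (1 / p\<^sup>2)" if u: "0 < u" "u \<le> 1" "0 < n" for n u
    unfolding S_def using step_function_eq(1)[OF u(3) u(1,2), of "c n"] c_le by simp
  have AE01: "AE u::real in lborel. u \<noteq> 0 \<and> u \<noteq> 1"
    using AE_lborel_singleton[of 0] AE_lborel_singleton[of 1] by eventually_elim simp
  have "(\<lambda>n. \<integral>\<^sup>+u. S (Suc n) u \<partial>lborel) \<longlonglongrightarrow> (\<integral>\<^sup>+u. C u * indicator {0..1} u \<partial>lborel)"
  proof (rule nn_integral_dominated_convergence[where w="\<lambda>u. ennreal (1 / p\<^sup>2) * indicator {0..1} u"])
    show "AE u in lborel. (\<lambda>n. S (Suc n) u) \<longlonglongrightarrow> C u * indicator {0..1} u"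
      using AE01
    proof eventually_elim
      case (elim u)
      then show ?case
        using lim_u[of u] S_out[of u] by (cases "u \<in> {0..1}") auto
    qed
    show "AE u in lborel. S (Suc n) u \<le> ennreal (1 / p\<^sup>2) * indicator {0..1} u" for n
      using AE01
    proof eventually_elim
      case (elim u)
      then show ?case
        using S_le[of u "Suc n"] S_out[of u "Suc n"] by (cases "u \<in> {0..1}") auto
    qed
    show "(\<integral>\<^sup>+u. ennreal (1 / p\<^sup>2) * indicator {0..1::real} u \<partial>lborel) < \<infinity>"
      by (simp add: nn_integral_cmult)
    show "S (Suc n) \<in> borel_measurable lborel" for n unfolding S_def by measurable
  qed measurable
  moreover have "(\<lambda>n. \<integral>\<^sup>+\<omega>. \<phi> (Zn (Suc n) \<omega>) \<partial>M) \<longlonglongrightarrow> (\<integral>\<^sup>+\<omega>. \<phi> (Z \<omega>) \<partial>M)"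
  proof (rule nn_integral_dominated_convergence[where w="\<lambda>_. ennreal (1 / p\<^sup>2)"])
    show "AE \<omega> in M. (\<lambda>n. \<phi> (Zn (Suc n) \<omega>)) \<longlonglongrightarrow> \<phi> (Z \<omega>)"
      using lim by eventually_elim (intro \<phi>_lim LIMSEQ_Suc)
  qed (measurable, auto intro!: \<phi>_le simp: M.emeasure_space_1)
  ultimately have "(\<integral>\<^sup>+\<omega>. \<phi> (Z \<omega>) \<partial>M) = (\<integral>\<^sup>+u. C u * indicator {0..1} u \<partial>lborel)"
    by (subst (asm) discrete) (auto intro: LIMSEQ_unique)
  also have "\<dots> = (\<integral>\<^sup>+u. \<integral>\<^sup>+s. \<integral>\<^sup>+\<omega>. \<phi> (u * max 0 s + (1 - u) * Z \<omega>) * indicator {0..1} u \<partial>M \<partial>B \<partial>lborel)"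
    unfolding C_def by (subst nn_integral_multc[symmetric], measurable)+
  also have "\<dots> = (\<integral>\<^sup>+s. \<integral>\<^sup>+u. \<integral>\<^sup>+\<omega>. \<phi> (u * max 0 s + (1 - u) * Z \<omega>) * indicator {0..1} u \<partial>M \<partial>lborel \<partial>B)"
    by (rule lB.Fubini') measurable
  also have "\<dots> = (\<integral>\<^sup>+s. \<integral>\<^sup>+\<omega>. \<integral>\<^sup>+u. \<phi> (u * max 0 s + (1 - u) * Z \<omega>) * indicator {0..1} u \<partial>lborel \<partial>M \<partial>B)"
    by (intro nn_integral_cong lM.Fubini') measurable
  also have "\<dots> = (\<integral>\<^sup>+s. \<integral>\<^sup>+\<omega>. ennreal (1 / (p + max 0 s)) * ennreal (1 / (p + Z \<omega>)) \<partial>M \<partial>B)"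
  proof (rule nn_integral_cong, rule nn_integral_cong_AE)
    fix s
    show "AE \<omega> in M. (\<integral>\<^sup>+u. \<phi> (u * max 0 s + (1 - u) * Z \<omega>) * indicator {0..1} u \<partial>lborel)
        = ennreal (1 / (p + max 0 s)) * ennreal (1 / (p + Z \<omega>))"
      using Z0
    proof eventually_elim
      case (elim \<omega>)
      have "(\<integral>\<^sup>+u. \<phi> (u * max 0 s + (1 - u) * Z \<omega>) * indicator {0..1} u \<partial>lborel)
          = (\<integral>\<^sup>+u. ennreal (1 / (p + (u * max 0 s + (1 - u) * Z \<omega>))\<^sup>2) * indicator {0..1} u \<partial>lborel)"
      proof (rule nn_integral_cong)
        fix u :: real
        have "0 \<le> u * max 0 s + (1 - u) * Z \<omega>" if "u \<in> {0..1}"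
          using that elim by (intro add_nonneg_nonneg mult_nonneg_nonneg) auto
        then show "\<phi> (u * max 0 s + (1 - u) * Z \<omega>) * indicator {0..1} u
          = ennreal (1 / (p + (u * max 0 s + (1 - u) * Z \<omega>))\<^sup>2) * indicator {0..1} u"
          by (cases "u \<in> {0..1}") (simp_all add: \<phi>_def max_absorb2)
      qed
      then show ?case using nn_integral_Feynman[OF p, of "max 0 s" "Z \<omega>"] elim by simp
    qed
  qed
  also have "\<dots> = (\<integral>\<^sup>+s. ennreal (1 / (p + max 0 s)) \<partial>B) * (\<integral>\<^sup>+\<omega>. ennreal (1 / (p + Z \<omega>)) \<partial>M)"
    by (simp add: nn_integral_cmult nn_integral_multc)
  also have "(\<integral>\<^sup>+\<omega>. \<phi> (Z \<omega>) \<partial>M) = (\<integral>\<^sup>+\<omega>. ennreal (1 / (p + Z \<omega>)\<^sup>2) \<partial>M)"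
  proof (rule nn_integral_cong_AE)
    show "AE \<omega> in M. \<phi> (Z \<omega>) = ennreal (1 / (p + Z \<omega>)\<^sup>2)"
      using Z0 by eventually_elim (simp add: \<phi>_def max_absorb2)
  qed
  finally show ?thesis unfolding B_def .
qed

section \<open>Logarithmic potential and Stieltjes transform of the half-Cauchy measure\<close>

text \<open>
  The exponent of the exit density, up to the factor \<open>1 / \<pi>\<close>: the logarithmic potential of the
  measure \<open>dw / (1 + w\<^sup>2)\<close> on the half-line.
\<close>
definition log_potential :: "real \<Rightarrow> real" where
  "log_potential r = (LBINT w:{0<..}. ln (r + w) / (1 + w\<^sup>2))"

text \<open>
  Closed form of \<open>\<integral>\<^sub>0\<^sup>\<infinity> dw / ((p + w) (1 + w\<^sup>2))\<close>, the derivative of the logarithmic potential.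
\<close>
definition half_cauchy_stieltjes :: "real \<Rightarrow> real" where
  "half_cauchy_stieltjes p = (p * pi / 2 - ln p) / (1 + p\<^sup>2)"

lemma nn_integral_half_cauchy_stieltjes:
  assumes p: "0 < p"
  shows "(\<integral>\<^sup>+w. ennreal (1 / ((p + w) * (1 + w\<^sup>2))) * indicator {0..} w \<partial>lborel) = ennreal (half_cauchy_stieltjes p)"
proof -
  (* The antiderivative comes from
     1 / ((p + w) (1 + w\<^sup>2)) = (1 / (p + w) + (p - w) / (1 + w\<^sup>2)) / (1 + p\<^sup>2). *)
  let ?F = "\<lambda>w. (ln (p + w) - ln (1 + w\<^sup>2) / 2 + p * arctan w) / (1 + p\<^sup>2)"
  have pos: "0 < 1 + w\<^sup>2" for w :: real by (simp add: add_pos_nonneg)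
  have "(\<integral>\<^sup>+w. ennreal (1 / ((p + w) * (1 + w\<^sup>2))) * indicator {0..} w \<partial>lborel)
      = ennreal (p * (pi / 2) / (1 + p\<^sup>2) - ?F 0)"
  proof (rule nn_integral_FTC_atLeast)
    fix w :: real assume w: "0 \<le> w"
    have "(1 / (p + w) - 2 * w / (1 + w\<^sup>2) / 2 + p * inverse (1 + w\<^sup>2)) / (1 + p\<^sup>2) = 1 / ((p + w) * (1 + w\<^sup>2))"
    proof -
      have "(1 / a - 2 * w / q / 2 + p * inverse q) = (q - w * a + p * a) / (a * q)"
        if "a \<noteq> 0" "q \<noteq> 0" for a q :: real
        using that by (simp add: field_simps)
      from this[of "p + w" "1 + w\<^sup>2"] have
        "(1 / (p + w) - 2 * w / (1 + w\<^sup>2) / 2 + p * inverse (1 + w\<^sup>2)) = (1 + p\<^sup>2) / ((p + w) * (1 + w\<^sup>2))"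
        using p w pos[of w] by (simp add: algebra_simps power2_eq_square)
      then show ?thesis using pos[of p] by simp
    qed
    moreover have "(?F has_real_derivative (1 / (p + w) - 2 * w / (1 + w\<^sup>2) / 2 + p * inverse (1 + w\<^sup>2)) / (1 + p\<^sup>2)) (at w)"
    proof -
      have d1: "((\<lambda>w. ln (p + w)) has_real_derivative 1 / (p + w)) (at w)"
        using p w by (auto intro!: derivative_eq_intros)
      have d2: "((\<lambda>w. ln (1 + w\<^sup>2)) has_real_derivative 2 * w / (1 + w\<^sup>2)) (at w)"
        using pos[of w] by (auto intro!: derivative_eq_intros)
      show ?thesis
        by (intro DERIV_cdivide DERIV_add DERIV_diff d1 d2 DERIV_cmult DERIV_arctan)
    qed
    ultimately show "(?F has_real_derivative 1 / ((p + w) * (1 + w\<^sup>2))) (at w)" by simp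
    show "0 \<le> 1 / ((p + w) * (1 + w\<^sup>2))" using p w pos[of w] by simp
  next
    have "((\<lambda>w. ln (p + w) - ln (1 + w\<^sup>2) / 2) \<longlongrightarrow> 0) at_top" by real_asymp
    then have "(?F \<longlongrightarrow> (0 + p * (pi / 2)) / (1 + p\<^sup>2)) at_top"
      using pos[of p] by (intro tendsto_intros tendsto_arctan_at_top) auto
    then show "(?F \<longlongrightarrow> p * (pi / 2) / (1 + p\<^sup>2)) at_top" by simp
  qed measurable
  then show ?thesis by (simp add: half_cauchy_stieltjes_def diff_divide_distrib)
qed

text \<open>
  Since \<open>ln (r + w)\<close> is at most a multiple of \<open>sqrt (1 + w)\<close>, the integrand is dominated by a multiple
  of \<open>(1 + w)\<^bsup>-3/2\<^esup>\<close>.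
\<close>
lemma set_integrable_log_potential:
  fixes r :: real
  assumes r: "0 < r"
  shows "set_integrable lborel {0<..} (\<lambda>w. ln (r + w) / (1 + w\<^sup>2))"
proof -
  let ?g = "\<lambda>w::real. (1 + w) powr (- 3 / 2)"
  have pos: "0 < 1 + w\<^sup>2" for w :: real by (simp add: add_pos_nonneg)
  have "(\<integral>\<^sup>+w. ennreal (?g w) * indicator {0..} w \<partial>lborel) = ennreal (0 - (- 2 * (1 + 0) powr (- 1 / 2)))"
  proof (rule nn_integral_FTC_atLeast)
    show "((\<lambda>w::real. - 2 * (1 + w) powr (- 1 / 2)) \<longlongrightarrow> 0) at_top" by real_asymp
    fix w :: real assume "0 \<le> w"
    then show "((\<lambda>w::real. - 2 * (1 + w) powr (- 1 / 2)) has_real_derivative ?g w) (at w)"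
      by (auto intro!: derivative_eq_intros)
  qed auto
  then have g: "set_integrable lborel {0<..} ?g"
  proof -
    assume *: "(\<integral>\<^sup>+w. ennreal (?g w) * indicator {0..} w \<partial>lborel) = ennreal (0 - (- 2 * (1 + 0) powr (- 1 / 2)))"
    have "(\<integral>\<^sup>+w. ennreal (norm (indicator {0<..} w *\<^sub>R ?g w)) \<partial>lborel)
        \<le> (\<integral>\<^sup>+w. ennreal (?g w) * indicator {0..} w \<partial>lborel)"
      by (intro nn_integral_mono) (auto split: split_indicator)
    with * show ?thesis unfolding set_integrable_def
      by (intro integrableI_bounded) (auto intro: le_less_trans)
  qed
  (* With m = min r 1 one has ln (r + w) - ln r \<le> ln ((1 + w) / m) \<le> 2 sqrt ((1 + w) / m), and
     1 / (1 + w\<^sup>2) \<le> 2 / (1 + w)\<^sup>2 gives the factor 2. *)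
  define C where "C = 2 * (\<bar>ln r\<bar> + 2 / sqrt (min r 1))"
  have bound: "\<bar>ln (r + w) / (1 + w\<^sup>2)\<bar> \<le> C * ?g w" if w: "0 < w" for w
  proof -
    define m where "m = min r 1"
    have m: "0 < m" "m \<le> r" "m \<le> 1" using r by (auto simp: m_def)
    have s: "1 \<le> sqrt (1 + w)" using w by simp
    have "ln (r + w) - ln r = ln (1 + w / r)"
      using r w by (subst ln_divide_pos[symmetric]) (auto simp: add_divide_distrib)
    also have "\<dots> \<le> ln ((1 + w) / m)"
    proof -
      have "w / r \<le> w / m" using m w by (intro divide_left_mono) auto
      moreover have "1 \<le> 1 / m" using m by simp
      ultimately have "1 + w / r \<le> (1 + w) / m" unfolding add_divide_distrib by (intro add_mono)
      then show ?thesis using r w by (intro ln_mono) (auto simp: add_pos_pos)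
    qed
    also have "\<dots> = 2 * ln (sqrt ((1 + w) / m))"
      using m w by (simp add: ln_sqrt)
    also have "\<dots> \<le> 2 * sqrt ((1 + w) / m)"
      using m w by (intro mult_left_mono less_imp_le[OF ln_less_self]) auto
    also have "\<dots> = 2 / sqrt m * sqrt (1 + w)" by (simp add: real_sqrt_divide)
    finally have "ln (r + w) - ln r \<le> 2 / sqrt m * sqrt (1 + w)" .
    moreover have "ln r \<le> ln (r + w)" using r w by simp
    ultimately have "\<bar>ln (r + w)\<bar> \<le> \<bar>ln r\<bar> + 2 / sqrt m * sqrt (1 + w)" by linarith
    also have "\<dots> \<le> \<bar>ln r\<bar> * sqrt (1 + w) + 2 / sqrt m * sqrt (1 + w)"
      using mult_left_mono[OF s, of "\<bar>ln r\<bar>"] by simp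
    finally have 1: "\<bar>ln (r + w)\<bar> \<le> (\<bar>ln r\<bar> + 2 / sqrt m) * sqrt (1 + w)"
      by (simp add: distrib_right)
    have "(1 + w)\<^sup>2 \<le> 2 * (1 + w\<^sup>2)"
      using zero_le_power2[of "w - 1"] by (simp add: power2_eq_square algebra_simps)
    then have 2: "1 / (1 + w\<^sup>2) \<le> 2 / (1 + w)\<^sup>2"
      using pos[of w] w by (simp add: divide_le_eq pos_le_divide_eq mult.commute)
    have 3: "sqrt (1 + w) * (2 / (1 + w)\<^sup>2) = 2 * (1 + w) powr (- 3 / 2)"
    proof -
      have "(1 + w) powr (- 3 / 2) = (1 + w) powr (1 / 2 - 2)" by simp
      also have "\<dots> = sqrt (1 + w) / (1 + w)\<^sup>2"
        using w by (subst powr_diff) (simp add: powr_half_sqrt)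
      finally show ?thesis by simp
    qed
    have "\<bar>ln (r + w) / (1 + w\<^sup>2)\<bar> = \<bar>ln (r + w)\<bar> * (1 / (1 + w\<^sup>2))"
      using pos[of w] by simp
    also have "\<dots> \<le> ((\<bar>ln r\<bar> + 2 / sqrt m) * sqrt (1 + w)) * (2 / (1 + w)\<^sup>2)"
      using 1 2 m w pos[of w] by (intro mult_mono) auto
    also have "\<dots> = C * (1 + w) powr (- 3 / 2)"
      unfolding mult.assoc 3 C_def m_def by simp
    finally show ?thesis .
  qed
  show ?thesis unfolding set_integrable_def
  proof (rule Bochner_Integration.integrable_bound)
    show "integrable lborel (\<lambda>w. C *\<^sub>R (indicator {0<..} w *\<^sub>R ?g w))"
      using g unfolding set_integrable_def by (rule integrable_scaleR_right)
    show "AE w in lborel. norm (indicator {0<..} w *\<^sub>R (ln (r + w) / (1 + w\<^sup>2))) \<le> norm (C *\<^sub>R (indicator {0<..} w *\<^sub>R ?g w))"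
    proof (rule AE_I2)
      fix w show "norm (indicator {0<..} w *\<^sub>R (ln (r + w) / (1 + w\<^sup>2))) \<le> norm (C *\<^sub>R (indicator {0<..} w *\<^sub>R ?g w))"
        using order_trans[OF bound abs_ge_self] by (auto split: split_indicator simp del: abs_divide)
    qed
  qed measurable
qed

lemma half_cauchy_stieltjes_nonneg:
  assumes "0 < p"
  shows "0 \<le> half_cauchy_stieltjes p"
proof -
  have "ln p \<le> p - 1" by (rule ln_le_minus_one[OF assms])
  also have "p * 1 \<le> p * (pi / 2)" using pi_gt3 assms by (intro mult_left_mono) auto
  then have "p - 1 \<le> p * (pi / 2)" by simp
  finally show ?thesis by (simp add: half_cauchy_stieltjes_def)
qed

lemma AE_lborel_indicator_Ioi: "AE w::real in lborel. indicator {0<..} w = (indicator {0..} w :: 'b::zero_neq_one)"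
  by (rule AE_I[where N="{0}"]) (auto simp: indicator_def split: if_splits)

lemma set_integral_half_cauchy_stieltjes:
  assumes p: "0 < p"
  shows "set_integrable lborel {0<..} (\<lambda>w. 1 / ((p + w) * (1 + w\<^sup>2)))"
    and "(LBINT w:{0<..}. 1 / ((p + w) * (1 + w\<^sup>2))) = half_cauchy_stieltjes p"
proof -
  let ?f = "\<lambda>w. indicator {0<..} w *\<^sub>R (1 / ((p + w) * (1 + w\<^sup>2)))"
  have "(\<integral>\<^sup>+w. ennreal (?f w) \<partial>lborel)
      = (\<integral>\<^sup>+w. ennreal (1 / ((p + w) * (1 + w\<^sup>2))) * indicator {0..} w \<partial>lborel)"
  proof (rule nn_integral_cong_AE)
    show "AE w in lborel. ennreal (?f w) = ennreal (1 / ((p + w) * (1 + w\<^sup>2))) * indicator {0..} w"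
      using AE_lborel_indicator_Ioi[where 'b=real] by eventually_elim (auto split: split_indicator split_indicator_asm)
  qed
  then have "(\<integral>\<^sup>+w. ennreal (?f w) \<partial>lborel) = ennreal (half_cauchy_stieltjes p)"
    using nn_integral_half_cauchy_stieltjes[OF p] by simp
  moreover have "AE w in lborel. 0 \<le> ?f w"
    using p by (intro AE_I2) (auto split: split_indicator simp: add_pos_pos add_nonneg_nonneg)
  ultimately have "has_bochner_integral lborel ?f (half_cauchy_stieltjes p)"
    using half_cauchy_stieltjes_nonneg[OF p] by (intro has_bochner_integral_nn_integral) auto
  then show "set_integrable lborel {0<..} (\<lambda>w. 1 / ((p + w) * (1 + w\<^sup>2)))"
    and "(LBINT w:{0<..}. 1 / ((p + w) * (1 + w\<^sup>2))) = half_cauchy_stieltjes p"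
    unfolding set_integrable_def set_lebesgue_integral_def has_bochner_integral_iff by auto
qed

text \<open>
  The potential inherits concavity from the logarithm.
\<close>
lemma log_potential_tangent:
  assumes p: "0 < p" and q: "0 < q"
  shows "log_potential q - log_potential p \<le> (q - p) * half_cauchy_stieltjes p"
proof -
  note ints = set_integrable_log_potential[OF p] set_integrable_log_potential[OF q] set_integral_half_cauchy_stieltjes(1)[OF p]
  have "log_potential q - log_potential p = (LBINT w:{0<..}. ln (q + w) / (1 + w\<^sup>2) - ln (p + w) / (1 + w\<^sup>2))"
    unfolding log_potential_def by (rule set_integral_diff(2)[symmetric]) (rule ints)+
  also have "\<dots> \<le> (LBINT w:{0<..}. (q - p) * (1 / ((p + w) * (1 + w\<^sup>2))))"
  proof (rule set_integral_mono)
    fix w :: real assume "w \<in> {0<..}"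
    then have w: "0 < w" by simp
    have "ln (q + w) - ln (p + w) \<le> (q - p) / (p + w)"
      using ln_diff_le[of "q + w" "p + w"] p q w by simp
    moreover have "0 < 1 + w\<^sup>2" by (simp add: add_pos_nonneg)
    ultimately have "(ln (q + w) - ln (p + w)) / (1 + w\<^sup>2) \<le> (q - p) / (p + w) / (1 + w\<^sup>2)"
      by (intro divide_right_mono) auto
    then show "ln (q + w) / (1 + w\<^sup>2) - ln (p + w) / (1 + w\<^sup>2) \<le> (q - p) * (1 / ((p + w) * (1 + w\<^sup>2)))"
      by (simp add: diff_divide_distrib)
  qed (rule set_integral_diff(1)[OF ints(2,1)] set_integrable_mult_right ints(3))+
  also have "\<dots> = (q - p) * half_cauchy_stieltjes p"
    by (simp only: set_integral_mult_right set_integral_half_cauchy_stieltjes(2)[OF p])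
  finally show ?thesis .
qed

text \<open>
  The tangent inequalities at \<open>p\<close> and at \<open>q\<close> squeeze the difference quotient between the values of
  the continuous function \<^const>\<open>half_cauchy_stieltjes\<close> at the two points.
\<close>
lemma DERIV_log_potential:
  assumes p: "0 < p"
  shows "(log_potential has_real_derivative half_cauchy_stieltjes p) (at p)"
proof -
  have "1 + p\<^sup>2 \<noteq> 0" using sum_power2_gt_zero_iff[of 1 p] by simp
  then have "isCont half_cauchy_stieltjes p"
    unfolding half_cauchy_stieltjes_def using p by (intro continuous_intros) auto
  then have lim: "((\<lambda>q. \<bar>half_cauchy_stieltjes q - half_cauchy_stieltjes p\<bar>) \<longlongrightarrow> 0) (at p)"
    unfolding isCont_def by (intro tendsto_rabs_zero LIM_zero)
  have "((\<lambda>q. (log_potential q - log_potential p) / (q - p) - half_cauchy_stieltjes p) \<longlongrightarrow> 0) (at p)"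
  proof (rule Lim_null_comparison[OF _ lim])
    have "norm ((log_potential q - log_potential p) / (q - p) - half_cauchy_stieltjes p)
        \<le> \<bar>half_cauchy_stieltjes q - half_cauchy_stieltjes p\<bar>" if q: "0 < q" "q \<noteq> p" for q
    proof -
      have 1: "log_potential q - log_potential p \<le> (q - p) * half_cauchy_stieltjes p"
        by (rule log_potential_tangent[OF p q(1)])
      have 2: "(q - p) * half_cauchy_stieltjes q \<le> log_potential q - log_potential p"
        using log_potential_tangent[OF q(1) p] by (simp add: algebra_simps)
      show ?thesis
      proof (cases "p < q")
        case True
        then have "(log_potential q - log_potential p) / (q - p) \<le> half_cauchy_stieltjes p"
          "half_cauchy_stieltjes q \<le> (log_potential q - log_potential p) / (q - p)"
          using 1 2 by (simp_all add: divide_le_eq le_divide_eq mult.commute)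
        then show ?thesis by simp
      next
        case False
        then have "half_cauchy_stieltjes p \<le> (log_potential q - log_potential p) / (q - p)"
          "(log_potential q - log_potential p) / (q - p) \<le> half_cauchy_stieltjes q"
          using 1 2 q(2) by (simp_all add: divide_le_eq le_divide_eq mult.commute)
        then show ?thesis by simp
      qed
    qed
    moreover have "\<forall>\<^sub>F q in at p. 0 < q \<and> q \<noteq> p"
      using p order_tendstoD(1)[OF tendsto_ident_at[of p UNIV], of 0]
      by (auto simp: eventually_conj_iff eventually_neq_at_within)
    ultimately show "\<forall>\<^sub>F q in at p. norm ((log_potential q - log_potential p) / (q - p) - half_cauchy_stieltjes p)
        \<le> \<bar>half_cauchy_stieltjes q - half_cauchy_stieltjes p\<bar>"
      by (auto elim!: eventually_mono)
  qed
  then show ?thesis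
    unfolding has_field_derivative_iff using LIM_zero_iff by blast
qed

lemma DERIV_zero_Ioi_const:
  fixes f :: "real \<Rightarrow> real"
  assumes "\<And>r. 0 < r \<Longrightarrow> (f has_real_derivative 0) (at r)" and "0 < r" "0 < s"
  shows "f r = f s"
  by (rule DERIV_isconst3[of 0 "max r s + 1"]) (use assms in auto)

text \<open>
  The two sides have the same derivative and agree at \<open>r = 1\<close>.
\<close>
lemma log_potential_inverse:
  assumes r: "0 < r"
  shows "log_potential (1 / r) = log_potential r - pi / 2 * ln r"
proof -
  let ?f = "\<lambda>r. log_potential (1 / r) - log_potential r + pi / 2 * ln r"
  have "(?f has_real_derivative 0) (at r)" if r: "0 < r" for r
  proof -
    have q: "1 + r\<^sup>2 \<noteq> 0" using sum_power2_gt_zero_iff[of 1 r] by simp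
    have "((\<lambda>r. 1 / r) has_real_derivative - (1 / r\<^sup>2)) (at r)"
      using r by (auto intro!: derivative_eq_intros simp: power2_eq_square)
    with DERIV_log_potential[of "1 / r"] r
    have "((\<lambda>r. log_potential (1 / r)) has_real_derivative half_cauchy_stieltjes (1 / r) * - (1 / r\<^sup>2)) (at r)"
      by (intro DERIV_chain2[of log_potential]) auto
    then have "(?f has_real_derivative (half_cauchy_stieltjes (1 / r) * - (1 / r\<^sup>2) - half_cauchy_stieltjes r + pi / 2 * (1 / r))) (at r)"
      using r by (intro DERIV_add DERIV_diff DERIV_cmult DERIV_log_potential) (auto intro!: derivative_eq_intros)
    moreover have "half_cauchy_stieltjes (1 / r) * - (1 / r\<^sup>2) - half_cauchy_stieltjes r + pi / 2 * (1 / r) = 0"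
    proof -
      have "half_cauchy_stieltjes (1 / r) * (1 / r\<^sup>2) = (pi / (2 * r) + ln r) / (r\<^sup>2 * (1 + (1 / r)\<^sup>2))"
        using r by (simp add: half_cauchy_stieltjes_def ln_div mult_ac)
      also have "r\<^sup>2 * (1 + (1 / r)\<^sup>2) = 1 + r\<^sup>2"
        using r by (simp add: power_divide distrib_left)
      finally have 1: "half_cauchy_stieltjes (1 / r) * (1 / r\<^sup>2) = (pi / (2 * r) + ln r) / (1 + r\<^sup>2)" .
      have "pi / (2 * r) + ln r + (r * pi / 2 - ln r) = pi / 2 * (1 / r) * (1 + r\<^sup>2)"
        using r by (simp add: field_simps power2_eq_square)
      then have "half_cauchy_stieltjes (1 / r) * (1 / r\<^sup>2) + half_cauchy_stieltjes r = pi / 2 * (1 / r)"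
        unfolding 1 unfolding half_cauchy_stieltjes_def add_divide_distrib[symmetric] using q by simp
      then show ?thesis by simp
    qed
    ultimately show ?thesis by simp
  qed
  then have "?f r = ?f 1"
    using r by (rule DERIV_zero_Ioi_const) auto
  then show ?thesis by simp
qed

lemma nn_integral_half_cauchy:
  "(\<integral>\<^sup>+w. ennreal (1 / (1 + w\<^sup>2)) * indicator {0..} w \<partial>lborel) = ennreal (pi / 2)"
proof -
  have "(\<integral>\<^sup>+w. ennreal (inverse (1 + w\<^sup>2)) * indicator {0..} w \<partial>lborel) = ennreal (pi / 2 - arctan 0)"
  proof (rule nn_integral_FTC_atLeast)
    show "(arctan has_real_derivative inverse (1 + w\<^sup>2)) (at w)" for w by (rule DERIV_arctan)
    show "(arctan \<longlongrightarrow> pi / 2) at_top" by (rule tendsto_arctan_at_top)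
    show "0 \<le> inverse (1 + w\<^sup>2)" for w :: real by (simp add: add_nonneg_nonneg)
  qed measurable
  then show ?thesis by (simp add: inverse_eq_divide)
qed

text \<open>
  The difference equals \<open>\<integral>\<^sub>0\<^sup>\<infinity> ln (1 + w / p) / (1 + w\<^sup>2) dw\<close> at \<open>p = n + 1\<close>, which vanishes in the limit
  by dominated convergence. This limit fixes the constant of integration in
  \<open>stieltjes_real_closed_form\<close>.
\<close>
lemma log_potential_asymptotics:
  "(\<lambda>n. log_potential (real (Suc n)) - pi / 2 * ln (real (Suc n))) \<longlonglongrightarrow> 0"
proof -
  have half: "set_integrable lborel {0<..} (\<lambda>w::real. 1 / (1 + w\<^sup>2))"
    "(LBINT w:{0<..}. 1 / (1 + w\<^sup>2)) = pi / 2"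
  proof -
    have "(\<integral>\<^sup>+w. ennreal (indicator {0<..} w *\<^sub>R (1 / (1 + w\<^sup>2))) \<partial>lborel)
        = (\<integral>\<^sup>+w. ennreal (1 / (1 + w\<^sup>2)) * indicator {0..} w \<partial>lborel)"
    proof (rule nn_integral_cong_AE)
      show "AE w in lborel. ennreal (indicator {0<..} w *\<^sub>R (1 / (1 + w\<^sup>2))) = ennreal (1 / (1 + w\<^sup>2)) * indicator {0..} w"
        using AE_lborel_singleton[of 0] by eventually_elim (simp add: indicator_def)
    qed
    also have "\<dots> = ennreal (pi / 2)" by (rule nn_integral_half_cauchy)
    finally have "has_bochner_integral lborel (\<lambda>w::real. indicator {0<..} w *\<^sub>R (1 / (1 + w\<^sup>2))) (pi / 2)"
      by (intro has_bochner_integral_nn_integral) (auto simp: add_nonneg_nonneg)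
    then show "set_integrable lborel {0<..} (\<lambda>w::real. 1 / (1 + w\<^sup>2))"
      "(LBINT w:{0<..}. 1 / (1 + w\<^sup>2)) = pi / 2"
      unfolding set_integrable_def set_lebesgue_integral_def has_bochner_integral_iff by auto
  qed
  have eq: "log_potential p - pi / 2 * ln p = (LBINT w:{0<..}. ln (1 + w / p) / (1 + w\<^sup>2))" if p: "0 < p" for p
  proof -
    have "log_potential p - pi / 2 * ln p
        = (LBINT w:{0<..}. ln (p + w) / (1 + w\<^sup>2)) - (LBINT w:{0<..}. ln p * (1 / (1 + w\<^sup>2)))"
      unfolding log_potential_def set_integral_mult_right half(2) by (simp only: mult.commute)
    also have "\<dots> = (LBINT w:{0<..}. ln (p + w) / (1 + w\<^sup>2) - ln p * (1 / (1 + w\<^sup>2)))"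
      by (rule set_integral_diff(2)[symmetric], rule set_integrable_log_potential[OF p])
        (rule set_integrable_mult_right, rule half(1))
    also have "\<dots> = (LBINT w:{0<..}. ln (1 + w / p) / (1 + w\<^sup>2))"
    proof (rule set_lebesgue_integral_cong)
      show "\<forall>w. w \<in> {0<..} \<longrightarrow> ln (p + w) / (1 + w\<^sup>2) - ln p * (1 / (1 + w\<^sup>2)) = ln (1 + w / p) / (1 + w\<^sup>2)"
      proof (intro allI impI)
        fix w :: real assume "w \<in> {0<..}"
        then have "ln (1 + w / p) = ln ((p + w) / p)" using p by (simp add: add_divide_distrib)
        also have "\<dots> = ln (p + w) - ln p" using p \<open>w \<in> {0<..}\<close> by (intro ln_divide_pos) auto
        finally show "ln (p + w) / (1 + w\<^sup>2) - ln p * (1 / (1 + w\<^sup>2)) = ln (1 + w / p) / (1 + w\<^sup>2)"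
          by (simp add: diff_divide_distrib)
      qed
    qed simp
    finally show ?thesis .
  qed
  have "(\<lambda>n. LBINT w:{0<..}. ln (1 + w / real (Suc n)) / (1 + w\<^sup>2)) \<longlonglongrightarrow> (LBINT w:{0<..}. 0 / (1 + (w::real)\<^sup>2))"
    unfolding set_lebesgue_integral_def
  proof (rule integral_dominated_convergence)
    show "integrable lborel (\<lambda>w::real. indicator {0<..} w *\<^sub>R (ln (1 + w) / (1 + w\<^sup>2)))"
      using set_integrable_log_potential[OF zero_less_one] unfolding set_integrable_def .
    show "AE w in lborel. (\<lambda>n. indicator {0<..} w *\<^sub>R (ln (1 + w / real (Suc n)) / (1 + w\<^sup>2)))
        \<longlonglongrightarrow> indicator {0<..} w *\<^sub>R (0 / (1 + w\<^sup>2))"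
    proof (rule AE_I2)
      fix w :: real
      have "0 < 1 + w\<^sup>2" by (simp add: add_pos_nonneg)
      moreover have "(\<lambda>n. w * inverse (real (Suc n))) \<longlonglongrightarrow> w * 0"
        by (intro tendsto_intros LIMSEQ_inverse_real_of_nat)
      then have "(\<lambda>n. ln (1 + w / real (Suc n))) \<longlonglongrightarrow> ln (1 + w * 0)"
        unfolding divide_inverse by (rule tendsto_ln[OF tendsto_add[OF tendsto_const]]) simp
      ultimately show "(\<lambda>n. indicator {0<..} w *\<^sub>R (ln (1 + w / real (Suc n)) / (1 + w\<^sup>2)))
        \<longlonglongrightarrow> indicator {0<..} w *\<^sub>R (0 / (1 + w\<^sup>2))"
        by (intro tendsto_intros) auto
    qed
    show "AE w in lborel. norm (indicator {0<..} w *\<^sub>R (ln (1 + w / real (Suc n)) / (1 + w\<^sup>2)))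
        \<le> indicator {0<..} w *\<^sub>R (ln (1 + w) / (1 + w\<^sup>2))" for n
    proof (rule AE_I2)
      fix w :: real
      have "\<bar>ln (1 + w / real (Suc n))\<bar> \<le> ln (1 + w)" if w: "0 < w"
      proof -
        have "w / real (Suc n) \<le> w / 1" using w by (intro divide_left_mono) auto
        moreover have "0 \<le> w / real (Suc n)" using w by simp
        ultimately have "0 \<le> ln (1 + w / real (Suc n))" "ln (1 + w / real (Suc n)) \<le> ln (1 + w)"
          by (simp_all del: of_nat_Suc add: ln_mono add_pos_nonneg)
        then show ?thesis by simp
      qed
      then have le: "\<bar>ln (1 + w / real (Suc n))\<bar> / (1 + w\<^sup>2) \<le> ln (1 + w) / (1 + w\<^sup>2)" if "0 < w"
        using that by (intro divide_right_mono) (auto simp: add_nonneg_nonneg)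
      have "norm (ln (1 + w / real (Suc n)) / (1 + w\<^sup>2)) = \<bar>ln (1 + w / real (Suc n))\<bar> / (1 + w\<^sup>2)"
        by (simp del: of_nat_Suc)
      with le show "norm (indicator {0<..} w *\<^sub>R (ln (1 + w / real (Suc n)) / (1 + w\<^sup>2)))
        \<le> indicator {0<..} w *\<^sub>R (ln (1 + w) / (1 + w\<^sup>2))"
        by (cases "0 < w") (simp_all del: of_nat_Suc abs_divide)
    qed
  qed measurable
  then show ?thesis by (simp only: eq of_nat_0_less_iff zero_less_Suc) simp
qed

text \<open>
  At time \<open>0\<close> the formula for the density degenerates to zero, while the law of the increment is
  a point mass.
\<close>
definition cauchy_law :: "real \<Rightarrow> real measure" where
  "cauchy_law t = (if t = 0 then return borel 0 else density lborel (\<lambda>y. ennreal (cauchy_density t 0 y)))"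

text \<open>
  The negative half of the line carries mass \<open>1 / 2\<close> and contributes \<open>1 / (2 p)\<close>.
\<close>
lemma nn_integral_cauchy_positive_part:
  assumes p: "0 < p"
  shows "(\<integral>\<^sup>+s. ennreal (1 / (p + max 0 s)) \<partial>cauchy_law 1) = ennreal (1 / (2 * p) + half_cauchy_stieltjes p / pi)"
proof -
  let ?d = "\<lambda>s::real. ennreal (1 / (1 + s\<^sup>2))"
  have q: "0 < 1 + s\<^sup>2" for s :: real by (simp add: add_pos_nonneg)
  have [measurable]: "(\<lambda>y. ennreal (cauchy_density 1 0 y)) \<in> borel_measurable borel"
    unfolding cauchy_density_def by measurable
  have "(\<integral>\<^sup>+s. ennreal (1 / (p + max 0 s)) \<partial>cauchy_law 1)
      = (\<integral>\<^sup>+s. ennreal (cauchy_density 1 0 s) * ennreal (1 / (p + max 0 s)) \<partial>lborel)"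
    unfolding cauchy_law_def by (simp add: nn_integral_density)
  also have "\<dots> = (\<integral>\<^sup>+s. ennreal (1 / pi) * (ennreal (1 / ((p + s) * (1 + s\<^sup>2))) * indicator {0..} s)
      + ennreal (1 / (pi * p)) * (?d s * indicator {..<0} s) \<partial>lborel)"
  proof (rule nn_integral_cong)
    fix s :: real
    have "ennreal (cauchy_density 1 0 s) * ennreal (1 / (p + max 0 s))
        = ennreal (1 / pi * (1 / (1 + s\<^sup>2)) * (1 / (p + max 0 s)))"
      using p q[of s] by (subst ennreal_mult[symmetric]) (auto simp: cauchy_density_def)
    also have "\<dots> = ennreal (1 / pi) * (ennreal (1 / ((p + s) * (1 + s\<^sup>2))) * indicator {0..} s)
      + ennreal (1 / (pi * p)) * (?d s * indicator {..<0} s)"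
    proof (cases "0 \<le> s")
      case True
      then show ?thesis using p q[of s]
        by (simp add: ennreal_mult[symmetric] max_absorb2 mult.commute)
    next
      case False
      then show ?thesis using p q[of s]
        by (simp add: ennreal_mult[symmetric] max_absorb1 mult_ac)
    qed
    finally show "ennreal (cauchy_density 1 0 s) * ennreal (1 / (p + max 0 s))
      = ennreal (1 / pi) * (ennreal (1 / ((p + s) * (1 + s\<^sup>2))) * indicator {0..} s)
      + ennreal (1 / (pi * p)) * (?d s * indicator {..<0} s)" .
  qed
  also have "\<dots> = ennreal (1 / pi) * (\<integral>\<^sup>+s. ennreal (1 / ((p + s) * (1 + s\<^sup>2))) * indicator {0..} s \<partial>lborel)
      + ennreal (1 / (pi * p)) * (\<integral>\<^sup>+s. ?d s * indicator {..<0} s \<partial>lborel)"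
    by (simp add: nn_integral_add nn_integral_cmult)
  also have "(\<integral>\<^sup>+s. ?d s * indicator {..<0} s \<partial>lborel) = (\<integral>\<^sup>+s. ?d s * indicator {0<..} s \<partial>lborel)"
  proof -
    have "(\<integral>\<^sup>+s. ?d s * indicator {..<0} s \<partial>lborel) = (\<integral>\<^sup>+s. ?d (0 + - 1 * s) * indicator {..<0} (0 + - 1 * s) \<partial>lborel)"
      by (subst nn_integral_real_affine[where c="-1" and t=0]) simp_all
    also have "\<dots> = (\<integral>\<^sup>+s. ?d s * indicator {0<..} s \<partial>lborel)"
      by (rule nn_integral_cong) (simp add: indicator_def)
    finally show ?thesis .
  qed
  also have "\<dots> = (\<integral>\<^sup>+s. ?d s * indicator {0..} s \<partial>lborel)"
  proof (rule nn_integral_cong_AE)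
    show "AE s in lborel. ?d s * indicator {0<..} s = ?d s * indicator {0..} s"
      using AE_lborel_indicator_Ioi[where 'b=ennreal] by eventually_elim simp
  qed
  also have "\<dots> = ennreal (pi / 2)" by (rule nn_integral_half_cauchy)
  also have "(\<integral>\<^sup>+s. ennreal (1 / ((p + s) * (1 + s\<^sup>2))) * indicator {0..} s \<partial>lborel) = ennreal (half_cauchy_stieltjes p)"
    by (rule nn_integral_half_cauchy_stieltjes[OF p])
  also have "ennreal (1 / pi) * ennreal (half_cauchy_stieltjes p) + ennreal (1 / (pi * p)) * ennreal (pi / 2)
      = ennreal (1 / (2 * p) + half_cauchy_stieltjes p / pi)"
  proof -
    have "ennreal (1 / pi) * ennreal (half_cauchy_stieltjes p) = ennreal (half_cauchy_stieltjes p / pi)"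
      using half_cauchy_stieltjes_nonneg[OF p] by (subst ennreal_mult[symmetric]) auto
    moreover have "ennreal (1 / (pi * p)) * ennreal (pi / 2) = ennreal (1 / (2 * p))"
      using p by (subst ennreal_mult[symmetric]) auto
    ultimately show ?thesis
      using p half_cauchy_stieltjes_nonneg[OF p] by (simp add: ennreal_plus[symmetric] add.commute del: ennreal_plus)
  qed
  finally show ?thesis .
qed

section \<open>Stieltjes transforms of laws on the half-line\<close>

definition stieltjes :: "real measure \<Rightarrow> complex \<Rightarrow> complex" where
  "stieltjes N z = (\<integral>v. 1 / (z + complex_of_real v) \<partial>N)"

text \<open>
  Away from the cut \<open>(-\<infinity>, 0]\<close> the kernels \<open>1 / (w + v)\<close>, \<open>v \<ge> 0\<close>, are bounded uniformly in
  \<open>v\<close> and locally uniformly in \<open>w\<close>; all estimates for Stieltjes transforms come from here.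
\<close>
lemma norm_add_of_real_bound:
  fixes z :: complex
  assumes "z \<notin> \<real>\<^sub>\<le>\<^sub>0"
  obtains r where "r > 0" "\<And>w v. w \<in> ball z r \<Longrightarrow> 0 \<le> v \<Longrightarrow> r \<le> norm (w + complex_of_real v)"
proof -
  have "open (- \<real>\<^sub>\<le>\<^sub>0 :: complex set)" by auto
  then obtain e where e: "e > 0" "ball z e \<subseteq> - \<real>\<^sub>\<le>\<^sub>0"
    using assms unfolding open_contains_ball by blast
  have "e / 2 \<le> norm (w + complex_of_real v)" if "w \<in> ball z (e/2)" "0 \<le> v" for w v
  proof (rule ccontr)
    assume "\<not> ?thesis"
    then have "dist w (- complex_of_real v) < e/2" by (simp add: dist_norm)
    with that(1) have "dist z (- complex_of_real v) < e"
      by (metis dist_commute dist_triangle_half_r mem_ball)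
    with e(2) have "- complex_of_real v \<notin> \<real>\<^sub>\<le>\<^sub>0" by auto
    then show False using that(2) by (simp add: complex_nonpos_Reals_iff)
  qed
  with e(1) show ?thesis using that[of "e/2"] by simp
qed

lemma norm_inverse_le:
  fixes u :: complex
  assumes "0 < r" "r \<le> norm u"
  shows "norm (1 / u) \<le> 1 / r"
  using assms by (simp add: norm_divide frac_le)

lemma (in prob_space) norm_integral_le_const:
  fixes f :: "'a \<Rightarrow> 'b::{banach, second_countable_topology}"
  assumes "AE x in M. norm (f x) \<le> B" and "0 \<le> B"
  shows "norm (\<integral>x. f x \<partial>M) \<le> B"
proof (cases "integrable M f")
  case True
  have "norm (\<integral>x. f x \<partial>M) \<le> (\<integral>x. norm (f x) \<partial>M)" by simp
  also have "\<dots> \<le> B" using True assms(1) by (intro integral_le_const) auto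
  finally show ?thesis .
qed (simp add: not_integrable_integral_eq assms(2))

locale nonneg_law = prob_space N for N :: "real measure" +
  assumes sets_N [measurable_cong]: "sets N = sets borel"
    and nonneg: "AE v in N. 0 \<le> v"
begin

lemma integrable_stieltjes:
  assumes "z \<notin> \<real>\<^sub>\<le>\<^sub>0"
  shows "integrable N (\<lambda>v. 1 / (z + complex_of_real v))"
proof -
  obtain r where r: "r > 0" "\<And>w v. w \<in> ball z r \<Longrightarrow> 0 \<le> v \<Longrightarrow> r \<le> norm (w + complex_of_real v)"
    using norm_add_of_real_bound[OF assms] by blast
  show ?thesis
  proof (rule integrable_const_bound)
    show "AE v in N. norm (1 / (z + complex_of_real v)) \<le> 1 / r"
      using nonneg by eventually_elim (use r in \<open>auto intro!: norm_inverse_le\<close>)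
  qed measurable
qed

text \<open>
  The difference quotient of the kernel differs from its derivative by
  \<open>(w - z) / ((w + v) (z + v)\<^sup>2)\<close>, which tends to zero uniformly in \<open>v\<close>.
\<close>
lemma has_field_derivative_stieltjes:
  assumes z: "z \<notin> \<real>\<^sub>\<le>\<^sub>0"
  shows "(stieltjes N has_field_derivative - (\<integral>v. 1 / (z + complex_of_real v)\<^sup>2 \<partial>N)) (at z)"
proof -
  obtain r where r: "r > 0" "\<And>w v. w \<in> ball z r \<Longrightarrow> 0 \<le> v \<Longrightarrow> r \<le> norm (w + complex_of_real v)"
    using norm_add_of_real_bound[OF z] by blast
  have rz: "r \<le> norm (z + complex_of_real v)" if "0 \<le> v" for v
    using r that by simp
  let ?D = "- (\<integral>v. 1 / (z + complex_of_real v)\<^sup>2 \<partial>N)"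
  have int2: "integrable N (\<lambda>v. 1 / (z + complex_of_real v)\<^sup>2)"
  proof (rule integrable_const_bound)
    show "AE v in N. norm (1 / (z + complex_of_real v)\<^sup>2) \<le> 1 / r\<^sup>2"
      using nonneg
      by eventually_elim (use r rz in \<open>auto simp: norm_power intro!: norm_inverse_le power_mono\<close>)
  qed measurable
  have bound: "norm ((stieltjes N w - stieltjes N z) / (w - z) - ?D) \<le> norm (w - z) / r^3"
    if w: "w \<in> ball z r" "w \<noteq> z" for w
  proof -
    have rw: "r \<le> norm (w + complex_of_real v)" if "0 \<le> v" for v
      using r w that by simp
    have "w \<notin> \<real>\<^sub>\<le>\<^sub>0"
    proof
      assume "w \<in> \<real>\<^sub>\<le>\<^sub>0"
      then have "w + complex_of_real (- Re w) = 0" "Re w \<le> 0"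
        by (auto simp: complex_nonpos_Reals_iff complex_eq_iff)
      with rw[of "- Re w"] r(1) show False by auto
    qed
    note ints = integrable_stieltjes[OF this] integrable_stieltjes[OF z] int2
    have eq: "(stieltjes N w - stieltjes N z) / (w - z) - ?D
        = (\<integral>v. (1 / (w + complex_of_real v) - 1 / (z + complex_of_real v)) / (w - z)
            + 1 / (z + complex_of_real v)\<^sup>2 \<partial>N)"
      using ints by (simp add: stieltjes_def)
    show ?thesis unfolding eq
    proof (rule norm_integral_le_const)
      show "AE v in N. norm ((1 / (w + complex_of_real v) - 1 / (z + complex_of_real v)) / (w - z)
            + 1 / (z + complex_of_real v)\<^sup>2) \<le> norm (w - z) / r^3"
        using nonneg
      proof eventually_elim
        case (elim v)
        let ?a = "w + complex_of_real v" and ?b = "z + complex_of_real v"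
        have ab: "r \<le> norm ?a" "r \<le> norm ?b" using rw rz elim by auto
        then have nz: "?a \<noteq> 0" "?b \<noteq> 0" using r(1) by auto
        have ba: "w - z = ?a - ?b" by simp
        have e: "(1 / ?a - 1 / ?b) / (w - z) + 1 / ?b\<^sup>2 = (w - z) * (1 / (?a * ?b\<^sup>2))"
        proof -
          have "(1 / a - 1 / b) / (a - b) + 1 / b\<^sup>2 = (a - b) * (1 / (a * b\<^sup>2))"
            if "a \<noteq> 0" "b \<noteq> 0" "a \<noteq> b" for a b :: complex
            using that by (simp add: field_simps power2_eq_square)
          from this[OF nz] w(2) show ?thesis unfolding ba by simp
        qed
        have "r * r\<^sup>2 \<le> norm ?a * (norm ?b)\<^sup>2"
          using ab r(1) by (intro mult_mono power_mono) auto
        then have "norm (1 / (?a * ?b\<^sup>2)) \<le> 1 / r^3"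
          using r(1) by (intro norm_inverse_le) (auto simp: norm_mult norm_power power3_eq_cube power2_eq_square)
        then show ?case
          unfolding e norm_mult by (metis mult_left_mono norm_ge_zero times_divide_eq_right mult.right_neutral)
      qed
    qed (use r(1) in simp)
  qed
  have "((\<lambda>w. (stieltjes N w - stieltjes N z) / (w - z) - ?D) \<longlongrightarrow> 0) (at z)"
  proof (rule Lim_null_comparison)
    show "\<forall>\<^sub>F w in at z. norm ((stieltjes N w - stieltjes N z) / (w - z) - ?D) \<le> norm (w - z) / r^3"
      using bound r(1) unfolding eventually_at by (auto simp: dist_commute)
    show "((\<lambda>w. norm (w - z) / r^3) \<longlongrightarrow> 0) (at z)"
      using r(1) by (auto intro!: tendsto_eq_intros)
  qed
  then show ?thesis
    unfolding has_field_derivative_iff using LIM_zero_iff by blast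
qed

lemma holomorphic_stieltjes: "stieltjes N holomorphic_on (- \<real>\<^sub>\<le>\<^sub>0)"
proof -
  have "open (- \<real>\<^sub>\<le>\<^sub>0 :: complex set)" by auto
  then show ?thesis
    using has_field_derivative_stieltjes unfolding holomorphic_on_open[OF \<open>open _\<close>] by blast
qed

lemma stieltjes_of_real:
  "stieltjes N (complex_of_real p) = complex_of_real (\<integral>v. 1 / (p + v) \<partial>N)"
  unfolding stieltjes_def integral_complex_of_real[symmetric] by simp

lemma stieltjes_square_of_real:
  "(\<integral>v. 1 / (complex_of_real p + complex_of_real v)\<^sup>2 \<partial>N) = complex_of_real (\<integral>v. 1 / (p + v)\<^sup>2 \<partial>N)"
  unfolding integral_complex_of_real[symmetric] by simp

text \<open>
  Dominated convergence: \<open>\<bar>z / (z + v)\<bar> \<le> 1\<close> if \<open>Re z \<ge> 0\<close>. The lemma is used along the positive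
  real axis and along both halves of the imaginary axis.
\<close>
lemma stieltjes_asymptotics:
  fixes w :: complex
  assumes w: "0 \<le> Re w" "w \<noteq> 0"
  shows "(\<lambda>n. (of_nat (Suc n) * w) * stieltjes N (of_nat (Suc n) * w)) \<longlonglongrightarrow> 1"
proof -
  have "(\<lambda>n. \<integral>v. (of_nat (Suc n) * w) / (of_nat (Suc n) * w + complex_of_real v) \<partial>N) \<longlonglongrightarrow> (\<integral>v. 1 \<partial>N)"
  proof (rule integral_dominated_convergence[where w="\<lambda>_. 1"])
    show "AE v in N. (\<lambda>n. (of_nat (Suc n) * w) / (of_nat (Suc n) * w + complex_of_real v)) \<longlonglongrightarrow> 1"
    proof (rule AE_I2)
      fix v
      have "(\<lambda>n. inverse (1 + (complex_of_real v / w) * inverse (of_nat (Suc n)))) \<longlonglongrightarrow> inverse (1 + (complex_of_real v / w) * 0)"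
        by (intro tendsto_intros LIMSEQ_Suc[OF lim_inverse_n]) auto
      moreover have "inverse (1 + (complex_of_real v / w) * inverse (of_nat (Suc n)))
          = (of_nat (Suc n) * w) / (of_nat (Suc n) * w + complex_of_real v)" for n
        using w(2) by (simp add: field_simps del: of_nat_Suc)
      ultimately show "(\<lambda>n. (of_nat (Suc n) * w) / (of_nat (Suc n) * w + complex_of_real v)) \<longlonglongrightarrow> 1"
        by simp
    qed
    show "AE v in N. norm ((of_nat (Suc n) * w) / (of_nat (Suc n) * w + complex_of_real v)) \<le> 1" for n
      using nonneg
    proof eventually_elim
      case (elim v)
      have "norm (of_nat (Suc n) * w) \<le> norm (of_nat (Suc n) * w + complex_of_real v)"
        unfolding cmod_def using w(1) elim
        by (intro real_sqrt_le_mono) (simp add: power_mono)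
      then show ?case by (simp add: norm_divide divide_le_eq_1)
    qed
  qed (simp_all del: of_nat_Suc)
  then show ?thesis
    unfolding stieltjes_def integral_mult_right_zero[symmetric] by (simp add: prob_space del: of_nat_Suc)
qed

end

section \<open>The reflection formula\<close>

text \<open>
  The laws whose Stieltjes transform \<open>\<alpha>\<close> satisfies \<open>- \<alpha>' = \<beta> \<alpha>\<close> on the positive axis, where
  \<open>\<beta>(p) = 1 / (2 p) + (p / 2 - ln p / \<pi>) / (1 + p\<^sup>2)\<close> is the Stieltjes transform of the positive part
  of a standard Cauchy variable. The equation determines the law on \<open>(0, \<infinity>)\<close>.
\<close>
locale cauchy_max_law = nonneg_law +
  assumes ode: "\<And>p. 0 < p \<Longrightarrow> (\<integral>v. 1 / (p + v)\<^sup>2 \<partial>N)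
    = (1 / (2 * p) + (p / 2 - ln p / pi) / (1 + p\<^sup>2)) * (\<integral>v. 1 / (p + v) \<partial>N)"
begin

text \<open>
  Both sides are holomorphic off the cut, so the identity theorem extends the equation from the
  positive axis. The factor \<open>1 + z\<^sup>2\<close> clears the removable singularity of \<open>\<beta>\<close> at \<open>\<i>\<close> and the one at \<open>- \<i>\<close>.
\<close>
lemma stieltjes_ode:
  assumes z: "z \<notin> \<real>\<^sub>\<le>\<^sub>0"
  shows "(1 + z\<^sup>2) * deriv (stieltjes N) z
    = - ((1 + z\<^sup>2) / (2 * z) + z / 2 - Ln z / of_real pi) * stieltjes N z"
proof -
  let ?S = "stieltjes N"
  let ?f = "\<lambda>z. (1 + z\<^sup>2) * deriv ?S z + ((1 + z\<^sup>2) / (2 * z) + z / 2 - Ln z / of_real pi) * ?S z"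
  let ?U = "complex_of_real ` {0<..}"
  have "?f z = 0"
  proof (rule analytic_continuation[where S="- \<real>\<^sub>\<le>\<^sub>0" and U="?U" and \<xi>=1 and f="?f"])
    show "open (- \<real>\<^sub>\<le>\<^sub>0 :: complex set)" by auto
    then show "?f holomorphic_on - \<real>\<^sub>\<le>\<^sub>0"
      by (intro holomorphic_intros holomorphic_stieltjes) auto
    have "- \<real>\<^sub>\<le>\<^sub>0 = - (complex_of_real ` {..0})"
      by (auto simp: complex_nonpos_Reals_iff complex_eq_iff image_iff)
    then show "connected (- \<real>\<^sub>\<le>\<^sub>0 :: complex set)"
      using starlike_slotted_complex_plane_left[of 0] starlike_imp_connected by metis
    show "?U \<subseteq> - \<real>\<^sub>\<le>\<^sub>0" by auto
    show "1 islimpt ?U"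
    proof -
      have "(1::real) islimpt {0<..}" by (simp add: interior_limit_point interior_open)
      moreover have "inj complex_of_real" by (simp add: inj_def)
      ultimately have "complex_of_real 1 islimpt ?U"
        by (intro islimpt_isCont_image) (auto simp: eventually_at_filter)
      then show ?thesis by simp
    qed
    fix u assume "u \<in> ?U"
    then obtain p where p: "p > 0" "u = of_real p" by auto
    then have u: "u \<notin> \<real>\<^sub>\<le>\<^sub>0" by auto
    have "1 + p\<^sup>2 \<noteq> 0" using sum_power2_gt_zero_iff[of 1 p] by simp
    then have "(1 + p\<^sup>2) * (\<integral>v. 1 / (p + v)\<^sup>2 \<partial>N)
        = ((1 + p\<^sup>2) / (2 * p) + p / 2 - ln p / pi) * (\<integral>v. 1 / (p + v) \<partial>N)"
      unfolding ode[OF p(1)] mult.assoc[symmetric] by (simp add: distrib_left)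
    from this[THEN arg_cong[of _ _ complex_of_real]] show "?f u = 0"
      using p DERIV_imp_deriv[OF has_field_derivative_stieltjes[OF u]]
      by (simp add: stieltjes_of_real stieltjes_square_of_real Ln_of_real)
  qed (use z in auto)
  then show ?thesis by (simp add: algebra_simps add_eq_0_iff)
qed

text \<open>
  The logarithmic derivative of \<open>\<alpha>(z) \<alpha>(- z)\<close> is \<open>\<beta>(- z) - \<beta>(z)\<close>. In this difference the logarithms
  leave only the
  constant \<open>\<i> \<pi>\<close>, and what remains is \<open>- 1 / z - 1 / (z + \<i>)\<close>. So the product in the claim is
  constant on the upper half-plane, and its value is read off from \<open>z \<alpha>(z) \<rightarrow> 1\<close> at infinity.
\<close>
lemma stieltjes_reflection:
  assumes z: "Im z > 0"
  shows "stieltjes N z * stieltjes N (- z) * (z * (z + \<i>)) = - 1"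
proof -
  let ?S = "stieltjes N" and ?H = "{z. Im z > 0}"
  define D where "D z = ?S z * ?S (- z) * (z * (z + \<i>))" for z
  have nonpos: "z \<notin> \<real>\<^sub>\<le>\<^sub>0" "- z \<notin> \<real>\<^sub>\<le>\<^sub>0" if "z \<in> ?H" for z
    using that by (auto simp: complex_nonpos_Reals_iff)
  have DS: "(?S has_field_derivative deriv ?S z) (at z)" if "z \<notin> \<real>\<^sub>\<le>\<^sub>0" for z
    using holomorphic_stieltjes that by (intro holomorphic_derivI) auto
  have D': "(D has_field_derivative (deriv ?S z * ?S (- z) - ?S z * deriv ?S (- z)) * (z * (z + \<i>))
      + ?S z * ?S (- z) * (2 * z + \<i>)) (at z)" if "z \<in> ?H" for z
  proof -
    have "(uminus has_field_derivative - 1) (at z)" by (auto intro!: derivative_eq_intros)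
    from DERIV_chain2[where f="?S" and g=uminus, OF DS[OF nonpos(2)[OF that]] this]
    have "((\<lambda>z. ?S (- z)) has_field_derivative - deriv ?S (- z)) (at z)" by simp
    note [derivative_intros] = this DS[OF nonpos(1)[OF that]]
    show ?thesis unfolding D_def
      by (auto intro!: derivative_eq_intros simp: algebra_simps)
  qed
  have D0: "(D has_field_derivative 0) (at z)" if "z \<in> ?H - {\<i>}" for z
  proof -
    from that have zH: "z \<in> ?H" and "z \<noteq> \<i>" by auto
    have z0: "z \<noteq> 0" using zH by auto
    have "1 + z\<^sup>2 = (z - \<i>) * (z + \<i>)" by (simp add: algebra_simps power2_eq_square)
    moreover have "z + \<i> \<noteq> 0" using zH by (auto simp: complex_eq_iff)
    ultimately have nz: "1 + z\<^sup>2 \<noteq> 0" using \<open>z \<noteq> \<i>\<close> by simp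
    have Ln: "Ln (- z) = Ln z - \<i> * of_real pi"
      using zH z0 by (simp add: Ln_minus)
    define l where "l = Ln z / of_real pi"
    define s t s' t' where "s = ?S z" "t = ?S (- z)" "s' = deriv ?S z" "t' = deriv ?S (- z)"
    have s': "(1 + z\<^sup>2) * s' = - ((1 + z\<^sup>2) / (2 * z) + z / 2 - l) * s"
      using stieltjes_ode[OF nonpos(1)[OF zH]] by (simp add: s_t_s'_t'_def l_def)
    have t': "(1 + z\<^sup>2) * t' = - (- ((1 + z\<^sup>2) / (2 * z)) - z / 2 - (l - \<i>)) * t"
      using stieltjes_ode[OF nonpos(2)[OF zH]]
      by (simp add: s_t_s'_t'_def l_def Ln diff_divide_distrib)
    have "(1 + z\<^sup>2) * ((s' * t - s * t') * (z * (z + \<i>)) + s * t * (2 * z + \<i>))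
        = (((1 + z\<^sup>2) * s') * t - s * ((1 + z\<^sup>2) * t')) * (z * (z + \<i>)) + s * t * ((1 + z\<^sup>2) * (2 * z + \<i>))"
      by (simp add: algebra_simps)
    also have "\<dots> = s * t * ((- (1 + z\<^sup>2) / z - z + \<i>) * (z * (z + \<i>)) + (1 + z\<^sup>2) * (2 * z + \<i>))"
      unfolding s' t' using z0 by (simp add: field_simps)
    also have "(- (1 + z\<^sup>2) / z - z + \<i>) * (z * (z + \<i>)) = (- (1 + z\<^sup>2) - z * z + \<i> * z) * (z + \<i>)"
      using z0 by (simp add: field_simps)
    also have "(- (1 + z\<^sup>2) - z * z + \<i> * z) * (z + \<i>) + (1 + z\<^sup>2) * (2 * z + \<i>) = 0"
      by (simp add: algebra_simps power2_eq_square)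
    finally have "(s' * t - s * t') * (z * (z + \<i>)) + s * t * (2 * z + \<i>) = 0"
      using nz by simp
    with D'[OF zH] show ?thesis by (simp add: s_t_s'_t'_def)
  qed
  have "convex ?H" by (simp add: convex_halfspace_Im_gt)
  then have "connected ?H" by (rule convex_connected)
  moreover have "open ?H" by (rule open_halfspace_Im_gt)
  moreover have "continuous_on ?H D"
    using D' DERIV_isCont by (blast intro: continuous_at_imp_continuous_on)
  ultimately obtain c where c: "\<And>z. z \<in> ?H \<Longrightarrow> D z = c"
    using DERIV_zero_connected_constant[of ?H "{\<i>}" D] D0 by blast
  (* Along z = (n + 1) \<i> the product is - (z \<alpha>(z)) ((- z) \<alpha>(- z)) (1 + 1 / (n + 1)). *)
  define u where "u n = of_nat (Suc n) * \<i>" for n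
  have "(\<lambda>n. (u n * ?S (u n)) * ((of_nat (Suc n) * - \<i>) * ?S (of_nat (Suc n) * - \<i>)) * - (1 + inverse (of_nat (Suc n))))
      \<longlonglongrightarrow> 1 * 1 * - (1 + 0)"
    unfolding u_def
    by (intro tendsto_intros stieltjes_asymptotics LIMSEQ_Suc[OF lim_inverse_n]) auto
  moreover have "(u n * ?S (u n)) * ((of_nat (Suc n) * - \<i>) * ?S (of_nat (Suc n) * - \<i>)) * - (1 + inverse (of_nat (Suc n))) = c" for n
  proof -
    have m: "of_nat (Suc n) * - \<i> = - u n" by (simp add: u_def)
    have "u n * inverse (of_nat (Suc n)) = \<i>"
      by (simp add: u_def field_simps del: of_nat_Suc)
    then have "(u n * ?S (u n)) * ((- u n) * ?S (- u n)) * - (1 + inverse (of_nat (Suc n))) = D (u n)"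
      unfolding D_def by (simp add: algebra_simps del: of_nat_Suc)
    also have "\<dots> = c" by (rule c) (simp add: u_def)
    finally show ?thesis unfolding m .
  qed
  ultimately have "c = - 1" by (simp add: LIMSEQ_const_iff)
  with c z show ?thesis by (simp add: D_def)
qed

end

section \<open>Stieltjes inversion: the density of the limiting maximum\<close>

context nonneg_law
begin

lemma stieltjes_real_pos:
  assumes "0 < p"
  shows "0 < (\<integral>v. 1 / (p + v) \<partial>N)"
proof -
  have int: "integrable N (\<lambda>v. 1 / (p + v))"
    using nonneg assms by (intro integrable_const_bound[where B="1/p"]) (auto simp: frac_le elim!: eventually_mono)
  have ge0: "AE v in N. 0 \<le> 1 / (p + v)"
    using nonneg assms by (auto elim!: eventually_mono)
  have "(\<integral>v. 1 / (p + v) \<partial>N) \<noteq> 0"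
  proof
    assume "(\<integral>v. 1 / (p + v) \<partial>N) = 0"
    with int ge0 have "AE v in N. 1 / (p + v) = 0"
      by (simp add: integral_nonneg_eq_0_iff_AE)
    with nonneg have "AE v in N. False"
      by eventually_elim (use assms in auto)
    then show False by simp
  qed
  moreover have "0 \<le> (\<integral>v. 1 / (p + v) \<partial>N)" using ge0 by (rule integral_nonneg_AE)
  ultimately show ?thesis by simp
qed

text \<open>
  Just above the cut, \<open>- Im \<alpha>\<close> is \<open>\<pi>\<close> times the convolution of \<open>N\<close> with a Cauchy density of scale
  \<open>e\<close>; integrating that density gives the arctangents.
\<close>
lemma nn_integral_Poisson_kernel:
  assumes e: "0 < e" and ab: "a \<le> b"
  shows "(\<integral>\<^sup>+y. ennreal (- Im (stieltjes N (Complex (- y) e))) * indicator {a..b} y \<partial>lborel)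
    = (\<integral>\<^sup>+v. ennreal (arctan ((b - v) / e) - arctan ((a - v) / e)) \<partial>N)"
proof -
  interpret P: pair_sigma_finite N lborel ..
  have kernel: "ennreal (- Im (stieltjes N (Complex (- y) e))) = (\<integral>\<^sup>+v. ennreal (e / (e\<^sup>2 + (y - v)\<^sup>2)) \<partial>N)" for y
  proof -
    have int: "integrable N (\<lambda>v. 1 / (Complex (- y) e + complex_of_real v))"
      using e by (intro integrable_stieltjes) (auto simp: complex_nonpos_Reals_iff)
    have Im: "- Im (1 / (Complex (- y) e + complex_of_real v)) = e / (e\<^sup>2 + (y - v)\<^sup>2)" for v
      by (simp add: Im_divide power2_eq_square algebra_simps)
    have "- Im (stieltjes N (Complex (- y) e)) = (\<integral>v. e / (e\<^sup>2 + (y - v)\<^sup>2) \<partial>N)"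
      unfolding stieltjes_def integral_Im[OF int, symmetric] Im[symmetric] by simp
    moreover have "integrable N (\<lambda>v. e / (e\<^sup>2 + (y - v)\<^sup>2))"
      unfolding Im[symmetric] using int by (intro Bochner_Integration.integrable_minus integrable_Im)
    ultimately show ?thesis
      using e by (subst nn_integral_eq_integral) auto
  qed
  have inner: "(\<integral>\<^sup>+y. ennreal (e / (e\<^sup>2 + (y - v)\<^sup>2)) * indicator {a..b} y \<partial>lborel)
      = ennreal (arctan ((b - v) / e) - arctan ((a - v) / e))" for v
  proof (subst nn_integral_FTC_Icc[where F="\<lambda>y. arctan ((y - v) / e)"])
    fix y
    have "e / (e\<^sup>2 + (y - v)\<^sup>2) = inverse (1 + ((y - v) / e)\<^sup>2) * (1 / e)"
      using e sum_power2_gt_zero_iff[of e "y - v"]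
      by (simp add: field_simps power2_eq_square)
    then show "((\<lambda>y. arctan ((y - v) / e)) has_real_derivative e / (e\<^sup>2 + (y - v)\<^sup>2)) (at y)"
      using e by (auto intro!: derivative_eq_intros)
  qed (use e ab in auto)
  have "(\<integral>\<^sup>+y. ennreal (- Im (stieltjes N (Complex (- y) e))) * indicator {a..b} y \<partial>lborel)
      = (\<integral>\<^sup>+y. \<integral>\<^sup>+v. ennreal (e / (e\<^sup>2 + (y - v)\<^sup>2)) * indicator {a..b} y \<partial>N \<partial>lborel)"
    unfolding kernel by (subst nn_integral_multc) auto
  also have "\<dots> = (\<integral>\<^sup>+v. \<integral>\<^sup>+y. ennreal (e / (e\<^sup>2 + (y - v)\<^sup>2)) * indicator {a..b} y \<partial>lborel \<partial>N)"
    by (rule P.Fubini') measurable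
  finally show ?thesis unfolding inner .
qed

end

context cauchy_max_law
begin

text \<open>
  By \<open>stieltjes_reflection\<close>, \<open>\<pi>\<close> times this function is the boundary value of \<open>- Im \<alpha>\<close> at the
  point \<open>- y\<close> of the cut, approached from above.
\<close>
definition max_density :: "real \<Rightarrow> real" where
  "max_density y = 1 / (pi * (y * (1 + y\<^sup>2) * (\<integral>v. 1 / (y + v) \<partial>N)))"

lemma max_density_pos: "0 < y \<Longrightarrow> 0 < max_density y"
  using stieltjes_real_pos[of y] by (simp add: max_density_def add_pos_nonneg)

text \<open>
  The reflection formula continues \<open>\<alpha>\<close> continuously from the upper half-plane to the cut without
  the origin, so on \<open>[a, b]\<close> the functions \<open>- Im \<alpha>\<close> converge boundedly as the scale of the Poisson
  kernel tends to zero. The sign functions, limits of the arctangents, give full weight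
  to interior points of the interval and half weight to its end points.
\<close>
lemma poisson_limit:
  assumes a: "0 < a" and ab: "a < b"
  shows "(\<integral>\<^sup>+v. ennreal (pi / 2 * (sgn (b - v) - sgn (a - v))) \<partial>N)
      = (\<integral>\<^sup>+y. ennreal (pi * max_density y) * indicator {a..b} y \<partial>lborel)"
    and "\<exists>B. \<forall>y\<in>{a..b}. pi * max_density y \<le> B"
proof -
  let ?S = "stieltjes N"
  (* By the reflection formula \<alpha>(- w) = - G w for Im w < 0, and G is continuous on Re w > 0, also
     across the positive axis. *)
  define G where "G w = 1 / (w * (w - \<i>) * ?S w)" for w
  have G: "Im (G (Complex y (- e))) = - Im (?S (Complex (- y) e))" if "0 < e" for y e
  proof -
    have "?S (Complex (- y) e) * ?S (- Complex (- y) e) * (Complex (- y) e * (Complex (- y) e + \<i>)) = - 1"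
      by (rule stieltjes_reflection) (simp add: that)
    moreover have w: "- Complex (- y) e = Complex y (- e)" by (simp add: complex_eq_iff)
    moreover have "Complex (- y) e * (Complex (- y) e + \<i>) = Complex y (- e) * (Complex y (- e) - \<i>)"
      by (simp add: complex_eq_iff algebra_simps)
    ultimately have "?S (Complex (- y) e) * (Complex y (- e) * (Complex y (- e) - \<i>) * ?S (Complex y (- e))) = - 1"
      by (simp add: mult_ac)
    moreover from this have "Complex y (- e) * (Complex y (- e) - \<i>) * ?S (Complex y (- e)) \<noteq> 0"
      by (metis mult_zero_right neg_equal_0_iff_equal zero_neq_one)
    ultimately have "?S (Complex (- y) e) = - G (Complex y (- e))"
      unfolding G_def by (subst (asm) nonzero_eq_divide_eq[symmetric]) simp_all
    then show ?thesis by simp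
  qed
  have S_nz: "?S w \<noteq> 0" if "0 < Re w" for w
  proof (cases "Im w" "0::real" rule: linorder_cases)
    case equal
    then have "w = of_real (Re w)" by (simp add: complex_eq_iff)
    then have "?S w = of_real (\<integral>v. 1 / (Re w + v) \<partial>N)" using stieltjes_of_real by metis
    then show ?thesis using stieltjes_real_pos[OF that] by simp
  next
    case less
    then show ?thesis using stieltjes_reflection[of "- w"] by auto
  next
    case greater
    then show ?thesis using stieltjes_reflection[of w] by auto
  qed
  let ?R = "{w. 0 < Re w}"
  have "open ?R" by (rule open_halfspace_Re_gt)
  have R_sub: "?R \<subseteq> - \<real>\<^sub>\<le>\<^sub>0" by (auto simp: complex_nonpos_Reals_iff)
  have contG: "continuous_on ?R G"
    unfolding G_def
    using S_nz holomorphic_on_imp_continuous_on[OF holomorphic_on_subset[OF holomorphic_stieltjes R_sub]]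
    by (auto intro!: continuous_intros)
  let ?K = "cbox (Complex a (- 1)) (Complex b 0)"
  have K: "w \<in> ?K \<longleftrightarrow> a \<le> Re w \<and> Re w \<le> b \<and> - 1 \<le> Im w \<and> Im w \<le> 0" for w
    by (auto simp: in_cbox_complex_iff)
  have "?K \<subseteq> ?R" unfolding subset_iff K using a by auto
  then have "compact (G ` ?K)"
    by (intro compact_continuous_image continuous_on_subset[OF contG]) auto
  then obtain B where B: "\<And>w. w \<in> ?K \<Longrightarrow> norm (G w) \<le> B"
    using compact_imp_bounded[of "G ` ?K"] by (auto simp: bounded_iff)
  have ImB: "Im (G (Complex y (- e))) \<le> B" if "y \<in> {a..b}" "0 \<le> e" "e \<le> 1" for y e
    using B[of "Complex y (- e)"] abs_Im_le_cmod[of "G (Complex y (- e))"] that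
    by (auto simp: in_cbox_complex_iff)
  have G_boundary: "Im (G (Complex y 0)) = pi * max_density y" if "0 < y" for y
  proof -
    let ?\<alpha> = "\<integral>v. 1 / (y + v) \<partial>N"
    have "?\<alpha> > 0" by (rule stieltjes_real_pos[OF that])
    have "G (Complex y 0) = 1 / (Complex y 0 * (Complex y 0 - \<i>) * of_real ?\<alpha>)"
      unfolding G_def by (simp add: Complex_eq stieltjes_of_real)
    also have "Complex y 0 * (Complex y 0 - \<i>) * of_real ?\<alpha> = Complex (y * y * ?\<alpha>) (- (y * ?\<alpha>))"
      by (simp add: complex_eq_iff)
    finally have "Im (G (Complex y 0)) = (y * ?\<alpha>) / ((y * y * ?\<alpha>)\<^sup>2 + (y * ?\<alpha>)\<^sup>2)"
      by (simp add: Im_divide)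
    also have "(y * y * ?\<alpha>)\<^sup>2 + (y * ?\<alpha>)\<^sup>2 = (y * ?\<alpha>) * (y * (1 + y\<^sup>2) * ?\<alpha>)"
      by (simp add: algebra_simps power2_eq_square)
    also have "(y * ?\<alpha>) / \<dots> = 1 / (y * (1 + y\<^sup>2) * ?\<alpha>)"
      using that \<open>?\<alpha> > 0\<close> by (intro nonzero_divide_mult_cancel_left) simp
    finally show ?thesis
      by (simp add: max_density_def)
  qed
  show "\<exists>B. \<forall>y\<in>{a..b}. pi * max_density y \<le> B"
    using ImB[of _ 0] G_boundary a by (intro exI[of _ B]) auto
  define e where "e n = inverse (real (Suc n))" for n
  have e: "0 < e n" "e n \<le> 1" for n by (auto simp: e_def field_simps)
  have e_lim: "e \<longlonglongrightarrow> 0" unfolding e_def by (rule LIMSEQ_inverse_real_of_nat)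
  have eq: "(\<integral>\<^sup>+y. ennreal (Im (G (Complex y (- e n)))) * indicator {a..b} y \<partial>lborel)
      = (\<integral>\<^sup>+v. ennreal (arctan ((b - v) / e n) - arctan ((a - v) / e n)) \<partial>N)" for n
    unfolding G[OF e(1)] by (rule nn_integral_Poisson_kernel[OF e(1)]) (use ab in simp)
  have lim1: "(\<lambda>n. \<integral>\<^sup>+y. ennreal (Im (G (Complex y (- e n)))) * indicator {a..b} y \<partial>lborel)
      \<longlonglongrightarrow> (\<integral>\<^sup>+y. ennreal (pi * max_density y) * indicator {a..b} y \<partial>lborel)"
  proof (rule nn_integral_dominated_convergence[where w="\<lambda>y. ennreal B * indicator {a..b} y"])
    show "AE y in lborel. (\<lambda>n. ennreal (Im (G (Complex y (- e n)))) * indicator {a..b} y)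
        \<longlonglongrightarrow> ennreal (pi * max_density y) * indicator {a..b} y"
    proof (rule AE_I2)
      fix y :: real
      show "(\<lambda>n. ennreal (Im (G (Complex y (- e n)))) * indicator {a..b} y)
        \<longlonglongrightarrow> ennreal (pi * max_density y) * indicator {a..b} y"
      proof (cases "y \<in> {a..b}")
        case True
        then have y: "0 < y" using a by auto
        have "(\<lambda>n. Complex y (- e n)) \<longlonglongrightarrow> Complex y (- 0)"
          by (intro tendsto_Complex tendsto_intros e_lim)
        moreover have "isCont G (Complex y 0)"
          using contG \<open>open ?R\<close> y by (auto simp: continuous_on_eq_continuous_at)
        ultimately have "(\<lambda>n. G (Complex y (- e n))) \<longlonglongrightarrow> G (Complex y 0)"
          using isCont_tendsto_compose by force
        then have "(\<lambda>n. ennreal (Im (G (Complex y (- e n))))) \<longlonglongrightarrow> ennreal (pi * max_density y)"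
          unfolding G_boundary[OF y, symmetric] by (intro tendsto_ennrealI tendsto_Im)
        then show ?thesis using True by simp
      qed simp
    qed
    show "AE y in lborel. ennreal (Im (G (Complex y (- e n)))) * indicator {a..b} y \<le> ennreal B * indicator {a..b} y" for n
      using ImB e[of n] by (intro AE_I2) (auto split: split_indicator intro!: ennreal_leI simp: less_imp_le)
    show "(\<integral>\<^sup>+y. ennreal B * indicator {a..b} y \<partial>lborel) < \<infinity>"
      using ab by (simp add: nn_integral_cmult ennreal_mult_less_top)
    show "(\<lambda>y. ennreal (Im (G (Complex y (- e n)))) * indicator {a..b} y) \<in> borel_measurable lborel" for n
      unfolding G[OF e(1)] unfolding stieltjes_def Complex_eq by measurable
    show "(\<lambda>y. ennreal (pi * max_density y) * indicator {a..b} y) \<in> borel_measurable lborel"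
      unfolding max_density_def by measurable
  qed measurable
  have u_e: "u / e n = u * real (Suc n)" for u n
    by (simp add: e_def divide_inverse del: of_nat_Suc)
  have arctan_lim: "(\<lambda>n. arctan (u / e n)) \<longlonglongrightarrow> pi / 2 * sgn u" for u
  proof (cases u "0::real" rule: linorder_cases)
    case equal
    then show ?thesis by simp
  next
    case less
    have "filterlim (\<lambda>n. u * real (Suc n)) at_bot sequentially"
      by (rule filterlim_tendsto_neg_mult_at_bot[OF tendsto_const less filterlim_real_Suc])
    then have "(\<lambda>n. arctan (u * real (Suc n))) \<longlonglongrightarrow> - (pi / 2)"
      by (rule filterlim_compose[OF tendsto_arctan_at_bot])
    then show ?thesis unfolding u_e sgn_neg[OF less] by simp
  next
    case greater
    have "filterlim (\<lambda>n. u * real (Suc n)) at_top sequentially"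
      by (rule filterlim_tendsto_pos_mult_at_top[OF tendsto_const greater filterlim_real_Suc])
    then have "(\<lambda>n. arctan (u * real (Suc n))) \<longlonglongrightarrow> pi / 2"
      by (rule filterlim_compose[OF tendsto_arctan_at_top])
    then show ?thesis unfolding u_e sgn_pos[OF greater] by simp
  qed
  have lim2: "(\<lambda>n. \<integral>\<^sup>+v. ennreal (arctan ((b - v) / e n) - arctan ((a - v) / e n)) \<partial>N)
      \<longlonglongrightarrow> (\<integral>\<^sup>+v. ennreal (pi / 2 * (sgn (b - v) - sgn (a - v))) \<partial>N)"
  proof (rule nn_integral_dominated_convergence[where w="\<lambda>_. ennreal pi"])
    show "AE v in N. (\<lambda>n. ennreal (arctan ((b - v) / e n) - arctan ((a - v) / e n)))
        \<longlonglongrightarrow> ennreal (pi / 2 * (sgn (b - v) - sgn (a - v)))"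
      unfolding right_diff_distrib by (intro AE_I2 tendsto_ennrealI tendsto_diff arctan_lim)
    show "AE v in N. ennreal (arctan ((b - v) / e n) - arctan ((a - v) / e n)) \<le> ennreal pi" for n
    proof (intro AE_I2 ennreal_leI)
      fix v show "arctan ((b - v) / e n) - arctan ((a - v) / e n) \<le> pi"
        using arctan_bounded[of "(b - v) / e n"] arctan_bounded[of "(a - v) / e n"] by linarith
    qed
  qed (measurable, simp add: emeasure_space_1)
  show "(\<integral>\<^sup>+v. ennreal (pi / 2 * (sgn (b - v) - sgn (a - v))) \<partial>N)
      = (\<integral>\<^sup>+y. ennreal (pi * max_density y) * indicator {a..b} y \<partial>lborel)"
    using lim1[unfolded eq] lim2 by (rule LIMSEQ_unique[symmetric])
qed
text \<open>
  An atom at the left end point of \<open>[c, c + d]\<close> contributes half of its mass in \<open>poisson_limit\<close>,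
  while the integral over the interval is of order \<open>d\<close>.
\<close>
lemma emeasure_singleton:
  assumes c: "0 < c"
  shows "emeasure N {c} = 0"
proof -
  obtain B where B: "\<And>y. y \<in> {c..c+1} \<Longrightarrow> pi * max_density y \<le> B"
    using poisson_limit(2)[of c "c + 1"] c by (metis less_add_one)
  have B0: "0 < B" using B[of c] max_density_pos[OF c] by (auto intro: less_le_trans[rotated])
  have le: "pi / 2 * prob {c} \<le> B * d" if d: "0 < d" "d \<le> 1" for d
  proof -
    have "ennreal (pi / 2 * prob {c}) = (\<integral>\<^sup>+v. ennreal (pi / 2) * indicator {c} v \<partial>N)"
      by (simp add: nn_integral_cmult sets_N emeasure_eq_measure ennreal_mult[symmetric])
    also have "\<dots> \<le> (\<integral>\<^sup>+v. ennreal (pi / 2 * (sgn (c + d - v) - sgn (c - v))) \<partial>N)"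
      using d by (intro nn_integral_mono) (auto split: split_indicator)
    also have "\<dots> = (\<integral>\<^sup>+y. ennreal (pi * max_density y) * indicator {c..c+d} y \<partial>lborel)"
      by (rule poisson_limit(1)) (use c d in auto)
    also have "\<dots> \<le> (\<integral>\<^sup>+y. ennreal B * indicator {c..c+d} y \<partial>lborel)"
      using B d by (intro nn_integral_mono) (auto split: split_indicator intro!: ennreal_leI)
    also have "\<dots> = ennreal (B * d)"
      using d B0 by (simp add: nn_integral_cmult ennreal_mult)
    finally show ?thesis using d B0 by simp
  qed
  have "pi / 2 * prob {c} \<le> 0"
  proof (rule field_le_epsilon)
    fix e :: real assume e: "0 < e"
    have "pi / 2 * prob {c} \<le> B * min 1 (e / B)" by (rule le) (use e B0 in auto)
    also have "\<dots> \<le> B * (e / B)" using B0 by (intro mult_left_mono) auto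
    finally show "pi / 2 * prob {c} \<le> 0 + e" using B0 by simp
  qed
  then have "prob {c} = 0"
    using measure_nonneg[of N "{c}"] by (simp add: mult_le_0_iff not_le[THEN iffD2, OF pi_gt_zero])
  then show ?thesis by (simp add: emeasure_eq_measure)
qed

lemma emeasure_Icc:
  assumes a: "0 < a" and ab: "a < b"
  shows "emeasure N {a..b} = (\<integral>\<^sup>+y. ennreal (max_density y) * indicator {a..b} y \<partial>lborel)"
proof -
  have "AE v in N. v \<noteq> c" if "0 < c" for c
    using emeasure_singleton[OF that] by (intro AE_I[where N="{c}"]) (auto simp: sets_N)
  from this[of a] this[of b] a ab have ae: "AE v in N. v \<noteq> a" "AE v in N. v \<noteq> b" by auto
  have max_density_meas [measurable]: "max_density \<in> borel_measurable borel" unfolding max_density_def by measurable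
  have "ennreal pi * emeasure N {a..b} = (\<integral>\<^sup>+v. ennreal pi * indicator {a..b} v \<partial>N)"
    by (simp add: nn_integral_cmult sets_N)
  also have "\<dots> = (\<integral>\<^sup>+v. ennreal (pi / 2 * (sgn (b - v) - sgn (a - v))) \<partial>N)"
  proof (rule nn_integral_cong_AE)
    show "AE v in N. ennreal pi * indicator {a..b} v = ennreal (pi / 2 * (sgn (b - v) - sgn (a - v)))"
      using ae by eventually_elim (use ab in \<open>auto simp: sgn_real_def split: split_indicator\<close>)
  qed
  also have "\<dots> = (\<integral>\<^sup>+y. ennreal (pi * max_density y) * indicator {a..b} y \<partial>lborel)"
    by (rule poisson_limit(1)[OF a ab])
  also have "\<dots> = (\<integral>\<^sup>+y. ennreal pi * (ennreal (max_density y) * indicator {a..b} y) \<partial>lborel)"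
    using a by (intro nn_integral_cong) (auto simp: ennreal_mult' split: split_indicator)
  also have "\<dots> = ennreal pi * (\<integral>\<^sup>+y. ennreal (max_density y) * indicator {a..b} y \<partial>lborel)"
    by (rule nn_integral_cmult) measurable
  finally show ?thesis
    by (subst (asm) ennreal_mult_cancel_left) simp_all
qed
end

section \<open>Closed form of the density\<close>

context nonneg_law
begin

lemma DERIV_stieltjes_real:
  assumes p: "0 < p"
  shows "((\<lambda>p. \<integral>v. 1 / (p + v) \<partial>N) has_real_derivative - (\<integral>v. 1 / (p + v)\<^sup>2 \<partial>N)) (at p)"
proof -
  have "complex_of_real p \<notin> \<real>\<^sub>\<le>\<^sub>0" using p by simp
  from has_vector_derivative_real_field[OF has_field_derivative_stieltjes[OF this]]
  have "((\<lambda>p. complex_of_real (\<integral>v. 1 / (p + v) \<partial>N)) has_vector_derivative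
      - complex_of_real (\<integral>v. 1 / (p + v)\<^sup>2 \<partial>N)) (at p)"
    by (simp add: stieltjes_of_real stieltjes_square_of_real)
  from bounded_linear.has_vector_derivative[OF bounded_linear_Re this]
  show ?thesis by (simp add: has_real_derivative_iff_has_vector_derivative)
qed

lemma stieltjes_real_asymptotics:
  "(\<lambda>n. real (Suc n) * (\<integral>v. 1 / (real (Suc n) + v) \<partial>N)) \<longlonglongrightarrow> 1"
proof -
  have "(of_nat (Suc n) * 1) * stieltjes N (of_nat (Suc n) * 1)
      = complex_of_real (real (Suc n) * (\<integral>v. 1 / (real (Suc n) + v) \<partial>N))" for n
    using stieltjes_of_real[of "real (Suc n)"] by (simp del: of_nat_Suc)
  with stieltjes_asymptotics[of 1]
  have "(\<lambda>n. complex_of_real (real (Suc n) * (\<integral>v. 1 / (real (Suc n) + v) \<partial>N))) \<longlonglongrightarrow> complex_of_real 1"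
    by (simp del: of_nat_Suc)
  then show ?thesis unfolding tendsto_of_real_iff .
qed

end

context cauchy_max_law
begin

text \<open>
  The logarithmic derivatives of the two sides agree by the differential equation, and the constant
  is determined by \<open>p \<alpha>(p) \<rightarrow> 1\<close> at infinity.
\<close>
lemma stieltjes_real_closed_form:
  assumes p: "0 < p"
  shows "ln (\<integral>v. 1 / (p + v) \<partial>N) = - ln p / 2 - log_potential p / pi"
proof -
  let ?\<alpha> = "\<lambda>p. \<integral>v. 1 / (p + v) \<partial>N"
  let ?\<Phi> = "\<lambda>p. ln (?\<alpha> p) + ln p / 2 + log_potential p / pi"
  have "(?\<Phi> has_real_derivative 0) (at p)" if p: "0 < p" for p
  proof -
    have pos: "0 < ?\<alpha> p" by (rule stieltjes_real_pos[OF p])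
    have "((\<lambda>p. ln (?\<alpha> p)) has_real_derivative 1 / ?\<alpha> p * - (\<integral>v. 1 / (p + v)\<^sup>2 \<partial>N)) (at p)"
      by (rule DERIV_chain2[OF DERIV_ln_divide[OF pos] DERIV_stieltjes_real[OF p]])
    then have "(?\<Phi> has_real_derivative
        (1 / ?\<alpha> p * - (\<integral>v. 1 / (p + v)\<^sup>2 \<partial>N) + 1 / p / 2 + half_cauchy_stieltjes p / pi)) (at p)"
      by (intro DERIV_add DERIV_cdivide DERIV_log_potential[OF p] DERIV_ln_divide[OF p])
    moreover have "1 / ?\<alpha> p * - (\<integral>v. 1 / (p + v)\<^sup>2 \<partial>N) + 1 / p / 2 + half_cauchy_stieltjes p / pi = 0"
    proof -
      have "half_cauchy_stieltjes p / pi = (p / 2 - ln p / pi) / (1 + p\<^sup>2)"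
        by (simp add: half_cauchy_stieltjes_def diff_divide_distrib)
      then show ?thesis unfolding ode[OF p] using pos by simp
    qed
    ultimately show ?thesis by simp
  qed
  then have const: "?\<Phi> p = ?\<Phi> (real (Suc n))" for n
    using p by (rule DERIV_zero_Ioi_const) auto
  have "?\<Phi> (real (Suc n)) = ln (real (Suc n) * ?\<alpha> (real (Suc n)))
      + (log_potential (real (Suc n)) - pi / 2 * ln (real (Suc n))) / pi" for n
  proof -
    have "ln (real (Suc n) * ?\<alpha> (real (Suc n))) = ln (real (Suc n)) + ln (?\<alpha> (real (Suc n)))"
      using stieltjes_real_pos[of "real (Suc n)"] by (intro ln_mult_pos) auto
    then show ?thesis by (simp add: diff_divide_distrib del: of_nat_Suc)
  qed
  moreover have "(\<lambda>n. ln (real (Suc n) * ?\<alpha> (real (Suc n)))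
      + (log_potential (real (Suc n)) - pi / 2 * ln (real (Suc n))) / pi) \<longlonglongrightarrow> ln 1 + 0 / pi"
    by (intro tendsto_add tendsto_divide tendsto_ln stieltjes_real_asymptotics log_potential_asymptotics tendsto_const) auto
  ultimately have "(\<lambda>n. ?\<Phi> p) \<longlonglongrightarrow> 0"
    using const by simp
  then have "?\<Phi> p = 0" by (simp add: LIMSEQ_const_iff)
  then show ?thesis by simp
qed

lemma stieltjes_real_inverse:
  assumes r: "0 < r"
  shows "(\<integral>v. 1 / (1 / r + v) \<partial>N) = r / exp (log_potential r / pi)"
proof -
  have "ln (\<integral>v. 1 / (1 / r + v) \<partial>N) = - ln (1 / r) / 2 - (log_potential r - pi / 2 * ln r) / pi"
    using stieltjes_real_closed_form[of "1 / r"] log_potential_inverse[OF r] r by simp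
  also have "\<dots> = ln r - log_potential r / pi"
    using r by (simp add: ln_div diff_divide_distrib)
  finally have "ln (\<integral>v. 1 / (1 / r + v) \<partial>N) = ln r - log_potential r / pi" .
  then have "exp (ln (\<integral>v. 1 / (1 / r + v) \<partial>N)) = exp (ln r - log_potential r / pi)" by simp
  then show ?thesis
    using stieltjes_real_pos[of "1 / r"] r by (simp add: exp_diff)
qed

text \<open>
  The density of the theorem, as the image of \<^term>\<open>max_density\<close> under \<open>y = x / t\<close> with Jacobian
  \<open>x / t\<^sup>2\<close>.
\<close>
lemma max_density_transform:
  assumes x: "0 < x" and t: "0 < t"
  shows "max_density (x / t) * (x / t\<^sup>2) = 1 / pi * (x / (t\<^sup>2 + x\<^sup>2)) * exp (1 / pi * log_potential (t / x))"
proof -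
  let ?E = "exp (log_potential (t / x) / pi)"
  have q: "t\<^sup>2 + x\<^sup>2 > 0" using x by (simp add: add_nonneg_pos)
  have "(\<integral>v. 1 / (x / t + v) \<partial>N) = t / x / ?E"
    using stieltjes_real_inverse[of "t / x"] x t by simp
  then have "max_density (x / t) = 1 / (pi * (x / t * (1 + (x / t)\<^sup>2) * (t / x / ?E)))"
    by (simp add: max_density_def)
  also have "x / t * (1 + (x / t)\<^sup>2) * (t / x / ?E) = (1 + (x / t)\<^sup>2) / ?E"
    using x t by simp
  also have "1 + (x / t)\<^sup>2 = (t\<^sup>2 + x\<^sup>2) / t\<^sup>2"
    using t by (simp add: power_divide add_divide_distrib)
  finally show ?thesis using x t q by simp
qed

lemma emeasure_transform:
  assumes x: "0 < x" and a: "0 < a" and ab: "a < b"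
  shows "emeasure N {x / b..x / a} = (\<integral>\<^sup>+t. ennreal (1 / pi * (x / (t\<^sup>2 + x\<^sup>2)) * exp (1 / pi * log_potential (t / x)))
    * indicator {a..b} t \<partial>lborel)"
proof -
  have max_density_meas [measurable]: "max_density \<in> borel_measurable borel" unfolding max_density_def by measurable
  have xab: "0 < x / b" "x / b < x / a" using x a ab by (auto simp: frac_less2)
  have "emeasure N {x / b..x / a} = (\<integral>\<^sup>+y. ennreal (max_density y) * indicator {x / b..x / a} y \<partial>lborel)"
    by (rule emeasure_Icc[OF xab])
  also have "\<dots> = (\<integral>\<^sup>+y. ennreal (max_density (0 + - 1 * y)) * indicator {x / b..x / a} (0 + - 1 * y) \<partial>lborel)"
    by (subst nn_integral_real_affine[where c="-1" and t=0]) simp_all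
  also have "\<dots> = (\<integral>\<^sup>+y. ennreal (max_density (- y)) * indicator {- (x / a)..- (x / b)} y \<partial>lborel)"
    by (intro nn_integral_cong) (auto simp: indicator_def)
  also have "\<dots> = (\<integral>\<^sup>+y. ennreal (max_density (- y) * indicator {- (x / a)..- (x / b)} y) \<partial>lborel)"
    by (intro nn_integral_cong) (auto simp: indicator_def)
  also have "\<dots> = (\<integral>\<^sup>+t. ennreal (max_density (- (- (x / t))) * (x / t\<^sup>2) * indicator {a..b} t) \<partial>lborel)"
  proof (rule nn_integral_substitution[where g="\<lambda>t. - (x / t)"])
    show "((\<lambda>t. - (x / t)) has_real_derivative x / t\<^sup>2) (at t)" if "t \<in> {a..b}" for t
      using that a by (auto intro!: derivative_eq_intros simp: power2_eq_square)
    show "continuous_on {a..b} (\<lambda>t. x / t\<^sup>2)"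
      using a by (auto intro!: continuous_intros)
  qed (use x a ab in \<open>auto simp: set_borel_measurable_def\<close>)
  also have "\<dots> = (\<integral>\<^sup>+t. ennreal (1 / pi * (x / (t\<^sup>2 + x\<^sup>2)) * exp (1 / pi * log_potential (t / x)))
    * indicator {a..b} t \<partial>lborel)"
  proof (rule nn_integral_cong)
    fix t show "ennreal (max_density (- (- (x / t))) * (x / t\<^sup>2) * indicator {a..b} t)
      = ennreal (1 / pi * (x / (t\<^sup>2 + x\<^sup>2)) * exp (1 / pi * log_potential (t / x))) * indicator {a..b} t"
      using max_density_transform[OF x, of t] a by (auto split: split_indicator)
  qed
  finally show ?thesis .
qed

text \<open>
  The intervals \<open>[x / T, x / a]\<close> exhaust the tail as \<open>a\<close> decreases to \<open>0\<close>.
\<close>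
lemma emeasure_tail:
  assumes x: "0 < x" and T: "0 < T"
  shows "emeasure N {x / T..} = (\<integral>\<^sup>+t. ennreal (1 / pi * (x / (t\<^sup>2 + x\<^sup>2)) * exp (1 / pi * log_potential (t / x)))
    * indicator {0<..T} t \<partial>lborel)"
proof -
  define h where "h t = ennreal (1 / pi * (x / (t\<^sup>2 + x\<^sup>2)) * exp (1 / pi * log_potential (t / x)))" for t
  have [measurable]: "h \<in> borel_measurable borel" unfolding h_def log_potential_def set_lebesgue_integral_def by measurable
  define a where "a n = T / real (Suc (Suc n))" for n
  have a: "0 < a n" "a n < T" for n using T by (auto simp: a_def divide_less_eq)
  have a_anti: "a n \<le> a m" if "m \<le> n" for m n
    unfolding a_def using T that by (intro divide_left_mono) auto
  have a_small: "\<exists>n. a n \<le> c" if "0 < c" for c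
  proof -
    obtain n where "T / c < real n" using reals_Archimedean2 by blast
    then have "a n \<le> c" using that T by (simp add: a_def divide_le_eq field_simps)
    then show ?thesis ..
  qed
  have "(\<lambda>n. emeasure N {x / T..x / a n}) \<longlonglongrightarrow> emeasure N (\<Union>n. {x / T..x / a n})"
  proof (rule Lim_emeasure_incseq)
    show "incseq (\<lambda>n. {x / T..x / a n})"
      unfolding incseq_def using a_anti a x by (auto intro: order_trans divide_left_mono)
  qed (auto simp: sets_N)
  also have "(\<Union>n. {x / T..x / a n}) = {x / T..}"
  proof (intro equalityI subsetI)
    fix y assume y: "y \<in> {x / T..}"
    then have "0 < y" using x T by (auto intro: less_le_trans[OF divide_pos_pos])
    then obtain n where "a n \<le> x / y" using a_small[of "x / y"] x by auto
    then have "y \<le> x / a n" using a(1)[of n] \<open>0 < y\<close> by (simp add: le_divide_eq divide_le_eq mult.commute)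
    with y show "y \<in> (\<Union>n. {x / T..x / a n})" by auto
  qed auto
  also have "(\<lambda>n. emeasure N {x / T..x / a n}) = (\<lambda>n. emeasure (density lborel h) {a n..T})"
    using emeasure_transform[OF x a] by (simp add: emeasure_density h_def)
  finally have 1: "(\<lambda>n. emeasure (density lborel h) {a n..T}) \<longlonglongrightarrow> emeasure N {x / T..}" .
  have "(\<lambda>n. emeasure (density lborel h) {a n..T}) \<longlonglongrightarrow> emeasure (density lborel h) (\<Union>n. {a n..T})"
  proof (rule Lim_emeasure_incseq)
    show "incseq (\<lambda>n. {a n..T})"
      unfolding incseq_def using a_anti by (auto intro: order_trans)
  qed auto
  also have "(\<Union>n. {a n..T}) = {0<..T}"
    using a_small by (auto intro: less_le_trans[OF a(1)])
  finally have "emeasure N {x / T..} = emeasure (density lborel h) {0<..T}"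
    using 1 LIMSEQ_unique by blast
  then show ?thesis by (simp add: emeasure_density h_def)
qed

end

section \<open>Right-continuous paths with left limits\<close>

text \<open>
  The one-sided limits bound the path near every point, and \<open>[0, T]\<close> is compact.
\<close>
lemma cadlag_bounded:
  assumes f: "cadlag f" and "0 \<le> T"
  obtains C where "\<And>t. 0 \<le> t \<Longrightarrow> t \<le> T \<Longrightarrow> \<bar>f t\<bar> \<le> C"
proof -
  have "\<exists>C. \<forall>s\<in>{0..T}. 0 \<le> s \<longrightarrow> \<bar>f s\<bar> \<le> C"
  proof (rule Bolzano[where P="\<lambda>a b. \<exists>C. \<forall>s\<in>{a..b}. 0 \<le> s \<longrightarrow> \<bar>f s\<bar> \<le> C", OF \<open>0 \<le> T\<close>])
    fix a b c
    assume "\<exists>C. \<forall>s\<in>{a..b}. 0 \<le> s \<longrightarrow> \<bar>f s\<bar> \<le> C" "\<exists>C. \<forall>s\<in>{b..c}. 0 \<le> s \<longrightarrow> \<bar>f s\<bar> \<le> C"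
    then obtain C D where CD: "\<And>s. s \<in> {a..b} \<Longrightarrow> 0 \<le> s \<Longrightarrow> \<bar>f s\<bar> \<le> C" "\<And>s. s \<in> {b..c} \<Longrightarrow> 0 \<le> s \<Longrightarrow> \<bar>f s\<bar> \<le> D"
      by blast
    have "\<bar>f s\<bar> \<le> max C D" if "s \<in> {a..c}" "0 \<le> s" for s
      using CD[of s] that by (cases "s \<le> b") auto
    then show "\<exists>C. \<forall>s\<in>{a..c}. 0 \<le> s \<longrightarrow> \<bar>f s\<bar> \<le> C" by blast
  next
    fix x :: real assume x: "0 \<le> x"
    have "(f \<longlongrightarrow> f x) (at_right x)" using f x by (simp add: cadlag_def)
    then have "((\<lambda>s. \<bar>f s\<bar>) \<longlongrightarrow> \<bar>f x\<bar>) (at_right x)" by (rule tendsto_rabs)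
    then have "\<forall>\<^sub>F s in at_right x. \<bar>f s\<bar> < \<bar>f x\<bar> + 1" by (rule order_tendstoD) simp
    then obtain b where b: "b > x" "\<And>s. x < s \<Longrightarrow> s < b \<Longrightarrow> \<bar>f s\<bar> < \<bar>f x\<bar> + 1"
      unfolding eventually_at_right_field by blast
    have "\<exists>a C. a < x \<and> (\<forall>s. 0 \<le> s \<longrightarrow> a < s \<longrightarrow> s < x \<longrightarrow> \<bar>f s\<bar> < C)"
    proof (cases "x = 0")
      case True
      then show ?thesis by (intro exI[of _ "- 1"] exI[of _ 0]) auto
    next
      case False
      then obtain l where "(f \<longlongrightarrow> l) (at_left x)" using f x unfolding cadlag_def by fastforce
      then have "((\<lambda>s. \<bar>f s\<bar>) \<longlongrightarrow> \<bar>l\<bar>) (at_left x)" by (rule tendsto_rabs)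
      then have "\<forall>\<^sub>F s in at_left x. \<bar>f s\<bar> < \<bar>l\<bar> + 1" by (rule order_tendstoD) simp
      then show ?thesis unfolding eventually_at_left_field by blast
    qed
    then obtain a C where a: "a < x" "\<And>s. 0 \<le> s \<Longrightarrow> a < s \<Longrightarrow> s < x \<Longrightarrow> \<bar>f s\<bar> < C" by blast
    show "\<exists>d>0. \<forall>u v. u \<le> x \<and> x \<le> v \<and> v - u < d \<longrightarrow> (\<exists>C. \<forall>s\<in>{u..v}. 0 \<le> s \<longrightarrow> \<bar>f s\<bar> \<le> C)"
    proof (rule exI[of _ "min (x - a) (b - x)"], intro conjI allI impI)
      show "0 < min (x - a) (b - x)" using a b by simp
      fix u v assume uv: "u \<le> x \<and> x \<le> v \<and> v - u < min (x - a) (b - x)"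
      have "\<bar>f s\<bar> \<le> max C (\<bar>f x\<bar> + 1)" if "s \<in> {u..v}" "0 \<le> s" for s
      proof (cases s x rule: linorder_cases)
        case less
        then show ?thesis using a(2)[of s] uv that by auto
      next
        case greater
        then show ?thesis using b(2)[of s] uv that by auto
      qed auto
      then show "\<exists>C. \<forall>s\<in>{u..v}. 0 \<le> s \<longrightarrow> \<bar>f s\<bar> \<le> C" by blast
    qed
  qed
  then obtain C where "\<forall>s\<in>{0..T}. 0 \<le> s \<longrightarrow> \<bar>f s\<bar> \<le> C" by blast
  then show ?thesis by (intro that[of C]) auto
qed

lemma grid_ceiling:
  assumes T: "0 < T" and t: "0 \<le> t" "t \<le> T" and n: "0 < n"
  defines "i \<equiv> nat \<lceil>t * real n / T\<rceil>"
  shows "i \<le> n" "t \<le> real i * (T / real n)" "real i * (T / real n) < t + T / real n"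
proof -
  have pos: "0 \<le> t * real n / T" using T t n by simp
  have "t * real n / T \<le> real n" using T t n by (simp add: divide_le_eq mult_right_mono mult.commute)
  then show "i \<le> n" unfolding i_def by linarith
  have "t * real n / T \<le> real i" unfolding i_def by linarith
  then have "t * real n / T * (T / real n) \<le> real i * (T / real n)" using T n by (intro mult_right_mono) auto
  then show "t \<le> real i * (T / real n)" using T n by simp
  have "real i < t * real n / T + 1" unfolding i_def using pos by linarith
  then have "real i * (T / real n) < (t * real n / T + 1) * (T / real n)" using T n by (intro mult_strict_right_mono) auto
  then show "real i * (T / real n) < t + T / real n" using T n by (simp add: distrib_right add_divide_distrib)
qed

text \<open>
  The grids of mesh \<open>T / n\<close> are not nested. But rounding a time up to the grid approaches it from the
  right and stays in \<open>[0, T]\<close>, so right-continuity suffices for convergence along all \<open>n\<close>.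
\<close>
lemma cadlag_grid_Max_tendsto:
  assumes f: "cadlag f" and T: "0 < T"
  defines "g \<equiv> \<lambda>t. f 0 - f t"
  shows "(\<lambda>n. Max ((\<lambda>i. g (real i * (T / real n))) ` {..n})) \<longlonglongrightarrow> (SUP t\<in>{0..T}. g t)"
    and "bdd_above (g ` {0..T})"
proof -
  obtain C where C: "\<And>t. 0 \<le> t \<Longrightarrow> t \<le> T \<Longrightarrow> \<bar>f t\<bar> \<le> C"
    using cadlag_bounded[OF f] T by (metis less_imp_le)
  show bdd: "bdd_above (g ` {0..T})"
  proof (rule bdd_aboveI2)
    fix t assume "t \<in> {0..T}"
    then show "g t \<le> C + C" using C[of t] C[of 0] T unfolding g_def by auto
  qed
  have grid: "real i * (T / real n) \<in> {0..T}" if "i \<le> n" "0 < n" for i n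
    using that T by (auto simp: divide_le_eq mult.commute mult_left_mono)
  let ?S = "SUP t\<in>{0..T}. g t"
  show "(\<lambda>n. Max ((\<lambda>i. g (real i * (T / real n))) ` {..n})) \<longlonglongrightarrow> ?S"
  proof (rule order_tendstoI)
    fix a assume "a < ?S"
    then obtain t where t: "t \<in> {0..T}" "a < g t"
      using less_cSUP_iff[OF _ bdd] T by auto
    have "(g \<longlongrightarrow> g t) (at_right t)"
      unfolding g_def using f t by (intro tendsto_intros) (auto simp: cadlag_def)
    then have "\<forall>\<^sub>F s in at_right t. a < g s" using t(2) by (rule order_tendstoD)
    then obtain b where b: "b > t" "\<And>s. t < s \<Longrightarrow> s < b \<Longrightarrow> a < g s"
      unfolding eventually_at_right_field by blast
    have "(\<lambda>n. T / real n) \<longlonglongrightarrow> 0" by (rule lim_const_over_n)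
    then have "\<forall>\<^sub>F n in sequentially. T / real n < b - t" using b(1) by (intro order_tendstoD) auto
    moreover have "\<forall>\<^sub>F n in sequentially. 0 < (n::nat)" by (rule eventually_gt_at_top)
    ultimately show "\<forall>\<^sub>F n in sequentially. a < Max ((\<lambda>i. g (real i * (T / real n))) ` {..n})"
    proof eventually_elim
      case (elim n)
      define i where "i = nat \<lceil>t * real n / T\<rceil>"
      have i: "i \<le> n" "t \<le> real i * (T / real n)" "real i * (T / real n) < t + T / real n"
        unfolding i_def using grid_ceiling[OF T, of t n] t elim by auto
      have "a < g (real i * (T / real n))"
        using b(2)[of "real i * (T / real n)"] i elim t(2) by (cases "t = real i * (T / real n)") auto
      also have "\<dots> \<le> Max ((\<lambda>i. g (real i * (T / real n))) ` {..n})"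
        using i(1) by (intro Max_ge) auto
      finally show ?case .
    qed
  next
    fix a assume a: "?S < a"
    have "\<forall>\<^sub>F n in sequentially. 0 < (n::nat)" by (rule eventually_gt_at_top)
    then show "\<forall>\<^sub>F n in sequentially. Max ((\<lambda>i. g (real i * (T / real n))) ` {..n}) < a"
    proof eventually_elim
      case (elim n)
      have "g (real i * (T / real n)) \<le> ?S" if "i \<le> n" for i
        by (rule cSUP_upper[OF grid[OF that elim] bdd])
      then show ?case using a by (subst Max_less_iff) (auto intro: le_less_trans)
    qed
  qed
qed

text \<open>
  Right-continuity keeps the path positive on some interval beyond \<open>T\<close>, which makes the inequality
  strict.
\<close>
lemma exit_time_gt:
  assumes f: "cadlag (\<lambda>t. X t \<omega>)" and T: "0 \<le> T" and pos: "\<And>t. 0 \<le> t \<Longrightarrow> t \<le> T \<Longrightarrow> 0 < X t \<omega>"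
  shows "ereal T < exit_time X {0<..} \<omega>"
proof -
  have "((\<lambda>t. X t \<omega>) \<longlongrightarrow> X T \<omega>) (at_right T)" using f T by (simp add: cadlag_def)
  then have "\<forall>\<^sub>F s in at_right T. 0 < X s \<omega>" using pos[OF T] by (intro order_tendstoD) auto
  then obtain b where b: "b > T" "\<And>s. T < s \<Longrightarrow> s < b \<Longrightarrow> 0 < X s \<omega>"
    unfolding eventually_at_right_field by blast
  have "ereal b \<le> exit_time X {0<..} \<omega>" unfolding exit_time_def
  proof (rule INF_greatest)
    fix t assume t: "t \<in> {t. 0 \<le> t \<and> X t \<omega> \<notin> {0<..}}"
    then have "\<not> t < b" using b(2)[of t] pos[of t] by (cases "t \<le> T") auto
    then show "ereal b \<le> ereal t" by simp
  qed
  then show ?thesis using b(1) less_le_trans[of "ereal T" "ereal b"] by simp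
qed

text \<open>
  Between the two implications only the case of equality is left open: the path may approach \<open>0\<close>
  from above, through its left limits, without reaching it.
\<close>
lemma exit_time_le_sup:
  assumes f: "cadlag (\<lambda>t. X t \<omega>)" and T: "0 < T"
  shows "X 0 \<omega> < (SUP t\<in>{0..T}. X 0 \<omega> - X t \<omega>) \<Longrightarrow> exit_time X {0<..} \<omega> \<le> ereal T"
    and "exit_time X {0<..} \<omega> \<le> ereal T \<Longrightarrow> X 0 \<omega> \<le> (SUP t\<in>{0..T}. X 0 \<omega> - X t \<omega>)"
proof -
  note bdd = cadlag_grid_Max_tendsto(2)[OF f T]
  show "exit_time X {0<..} \<omega> \<le> ereal T" if "X 0 \<omega> < (SUP t\<in>{0..T}. X 0 \<omega> - X t \<omega>)"
  proof -
    from that obtain t where t: "t \<in> {0..T}" "X 0 \<omega> < X 0 \<omega> - X t \<omega>"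
      using less_cSUP_iff[OF _ bdd] T by auto
    have "exit_time X {0<..} \<omega> \<le> ereal t" unfolding exit_time_def
      by (rule INF_lower) (use t in auto)
    also have "\<dots> \<le> ereal T" using t by simp
    finally show ?thesis .
  qed
  show "X 0 \<omega> \<le> (SUP t\<in>{0..T}. X 0 \<omega> - X t \<omega>)" if le: "exit_time X {0<..} \<omega> \<le> ereal T"
  proof (rule ccontr)
    assume "\<not> ?thesis"
    then have "0 < X t \<omega>" if "0 \<le> t" "t \<le> T" for t
      using cSUP_upper[OF _ bdd, of t] that by auto
    with exit_time_gt[of X \<omega> T, OF f] T have "ereal T < exit_time X {0<..} \<omega>" by simp
    with le show False by simp
  qed
qed

section \<open>Maxima of the Cauchy process along a grid\<close>

lemma (in prob_space) indep_vars_pair_distr: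
  fixes Y :: "'i \<Rightarrow> 'a \<Rightarrow> real" and U V :: "'a \<Rightarrow> real"
  assumes ind: "indep_vars (\<lambda>_. borel) Y I"
    and AB: "A \<inter> B = {}" "A \<subseteq> I" "B \<subseteq> I"
    and f: "f \<in> borel_measurable (PiM A (\<lambda>_. borel))"
    and g: "g \<in> borel_measurable (PiM B (\<lambda>_. borel))"
    and U: "\<And>\<omega>. U \<omega> = f (\<lambda>i\<in>A. Y i \<omega>)" and V: "\<And>\<omega>. V \<omega> = g (\<lambda>i\<in>B. Y i \<omega>)"
  shows "distr M (borel \<Otimes>\<^sub>M borel) (\<lambda>\<omega>. (U \<omega>, V \<omega>)) = distr M borel U \<Otimes>\<^sub>M distr M borel V"
    and "U \<in> borel_measurable M" and "V \<in> borel_measurable M"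
proof -
  have "indep_var borel (f \<circ> (\<lambda>\<omega>. \<lambda>i\<in>A. Y i \<omega>)) borel (g \<circ> (\<lambda>\<omega>. \<lambda>i\<in>B. Y i \<omega>))"
    by (rule indep_var_compose[OF indep_var_restrict[OF ind AB] f g])
  moreover have "f \<circ> (\<lambda>\<omega>. \<lambda>i\<in>A. Y i \<omega>) = U" "g \<circ> (\<lambda>\<omega>. \<lambda>i\<in>B. Y i \<omega>) = V"
    using U V by (auto simp: fun_eq_iff)
  ultimately have "indep_var borel U borel V" by simp
  then show "distr M (borel \<Otimes>\<^sub>M borel) (\<lambda>\<omega>. (U \<omega>, V \<omega>)) = distr M borel U \<Otimes>\<^sub>M distr M borel V"
    and "U \<in> borel_measurable M" and "V \<in> borel_measurable M"
    unfolding indep_var_distribution_eq by auto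
qed

text \<open>
  The pathwise version of \<^const>\<open>walk_max_law\<close>, as a function of the sequence of steps.
\<close>
primrec walk_max :: "nat \<Rightarrow> (nat \<Rightarrow> real) \<Rightarrow> real" where
  "walk_max 0 f = 0"
| "walk_max (Suc n) f = max 0 (f 0 + walk_max n (\<lambda>i. f (Suc i)))"

lemma walk_max_cong: "(\<And>i. i < n \<Longrightarrow> f i = g i) \<Longrightarrow> walk_max n f = walk_max n g"
proof (induction n arbitrary: f g)
  case (Suc n)
  have "walk_max n (\<lambda>i. f (Suc i)) = walk_max n (\<lambda>i. g (Suc i))"
    by (rule Suc.IH) (simp add: Suc.prems)
  then show ?case using Suc.prems[of 0] by simp
qed simp

lemma walk_max_measurable:
  "(\<And>i. i < n \<Longrightarrow> (\<lambda>\<omega>. f i \<omega>) \<in> borel_measurable M) \<Longrightarrow> (\<lambda>\<omega>. walk_max n (\<lambda>i. f i \<omega>)) \<in> borel_measurable M"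
proof (induction n arbitrary: f)
  case (Suc n)
  have "(\<lambda>\<omega>. walk_max n (\<lambda>i. f (Suc i) \<omega>)) \<in> borel_measurable M"
    by (rule Suc.IH) (simp add: Suc.prems)
  moreover have "f 0 \<in> borel_measurable M" using Suc.prems[of 0] by simp
  ultimately show ?case by simp
qed simp

lemma walk_max_eq_Max:
  "walk_max n (\<lambda>i. c i - c (Suc i)) = Max ((\<lambda>i. c 0 - c i) ` {..n})"
proof (induction n arbitrary: c)
  case (Suc n)
  have "(\<lambda>i. c 0 - c i) ` {..Suc n} = insert 0 ((\<lambda>i. (c 0 - c 1) + (c 1 - c (Suc i))) ` {..n})"
    by (auto simp: atMost_Suc_eq_insert_0 image_image)
  also have "Max \<dots> = max 0 (Max ((\<lambda>i. (c 0 - c 1) + (c 1 - c (Suc i))) ` {..n}))"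
    by (rule Max_insert) auto
  also have "Max ((\<lambda>i. (c 0 - c 1) + (c 1 - c (Suc i))) ` {..n})
      = (c 0 - c 1) + Max ((\<lambda>i. c 1 - c (Suc i)) ` {..n})"
    using Max_add_commute[of "{..n}" "\<lambda>i. c 1 - c (Suc i)" "c 0 - c 1"] by (simp add: add.commute)
  finally show ?case using Suc.IH[of "\<lambda>i. c (Suc i)"] by simp
qed simp

text \<open>
  The first step is independent of the maximum of the walk after it, so the two recursions match;
  the offset \<open>j\<close> makes the induction go through.
\<close>
lemma (in prob_space) distr_walk_max:
  fixes Y :: "nat \<Rightarrow> 'a \<Rightarrow> real"
  assumes ind: "indep_vars (\<lambda>_. borel) Y {..<K}"
    and law: "\<And>i. i < K \<Longrightarrow> distr M borel (Y i) = F"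
    and "j + n \<le> K"
  shows "distr M borel (\<lambda>\<omega>. walk_max n (\<lambda>i. Y (j + i) \<omega>)) = walk_max_law F n"
  using assms(3)
proof (induction n arbitrary: j)
  case 0
  show ?case by (simp add: distr_const)
next
  case (Suc n)
  let ?A = "{j}" and ?B = "{Suc j..<Suc j + n}"
  define V where "V \<omega> = walk_max n (\<lambda>i. Y (Suc j + i) \<omega>)" for \<omega>
  have V: "V \<omega> = walk_max n (\<lambda>i. (\<lambda>i\<in>?B. Y i \<omega>) (Suc j + i))" for \<omega>
    unfolding V_def by (rule walk_max_cong) simp
  have g: "(\<lambda>h. walk_max n (\<lambda>i. h (Suc j + i))) \<in> borel_measurable (PiM ?B (\<lambda>_. borel))"
    by (rule walk_max_measurable) (auto intro!: measurable_component_singleton)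
  have f: "(\<lambda>h. h j) \<in> borel_measurable (PiM ?A (\<lambda>_. borel))"
    by (auto intro!: measurable_component_singleton)
  have U: "Y j \<omega> = (\<lambda>h. h j) (\<lambda>i\<in>?A. Y i \<omega>)" for \<omega> by simp
  have AB: "?A \<inter> ?B = {}" "?A \<subseteq> {..<K}" "?B \<subseteq> {..<K}" using Suc.prems by auto
  note pair = indep_vars_pair_distr[OF ind AB f g U V]
  note [measurable] = pair(2,3)
  have "distr M borel (\<lambda>\<omega>. walk_max (Suc n) (\<lambda>i. Y (j + i) \<omega>)) = distr M borel (\<lambda>\<omega>. max 0 (Y j \<omega> + V \<omega>))"
    by (simp add: V_def)
  also have "\<dots> = distr (distr M (borel \<Otimes>\<^sub>M borel) (\<lambda>\<omega>. (Y j \<omega>, V \<omega>))) borel (\<lambda>(x, m). max 0 (x + m))"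
    by (subst distr_distr) (simp_all add: comp_def)
  also have "\<dots> = distr (F \<Otimes>\<^sub>M walk_max_law F n) borel (\<lambda>(x, m). max 0 (x + m))"
    unfolding pair(1) using law[of j] Suc.IH[of "Suc j", folded V_def] Suc.prems by simp
  finally show ?case by simp
qed

lemma sets_cauchy_law [simp, measurable_cong]: "sets (cauchy_law t) = sets borel"
  by (simp add: cauchy_law_def)

text \<open>
  Symmetry and self-similarity of the Cauchy laws.
\<close>
lemma (in prob_space) distr_cauchy_scale:
  assumes Y: "distributed M lborel Y (\<lambda>y. ennreal (cauchy_density h 0 y))"
    and h: "0 < h" and c: "c \<noteq> 0"
  shows "distr M borel (\<lambda>\<omega>. c * Y \<omega>) = cauchy_law (\<bar>c\<bar> * h)"
proof -
  have "distributed M lborel (\<lambda>\<omega>. 0 + c * Y \<omega>) (\<lambda>y. ennreal (cauchy_density h 0 ((y - 0) / c)) / ennreal \<bar>c\<bar>)"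
    by (rule distributed_affine[OF Y c])
  moreover have "ennreal (cauchy_density h 0 ((y - 0) / c)) / ennreal \<bar>c\<bar> = ennreal (cauchy_density (\<bar>c\<bar> * h) 0 y)" for y
  proof -
    define d A where "d = \<bar>c\<bar>" and "A = h\<^sup>2 + (y / c)\<^sup>2"
    have dA: "0 < d" "0 < A" using h c by (simp_all add: d_def A_def add_pos_nonneg)
    have "(d * h)\<^sup>2 + y\<^sup>2 = d\<^sup>2 * A"
      using c by (simp add: d_def A_def power_mult_distrib power_divide distrib_left)
    moreover have "d * h / (d\<^sup>2 * A) = h / A / d"
      using dA by (simp add: power2_eq_square)
    ultimately have "cauchy_density h 0 ((y - 0) / c) / \<bar>c\<bar> = cauchy_density (\<bar>c\<bar> * h) 0 y"
      by (simp add: cauchy_density_def flip: d_def A_def)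
    moreover have "0 \<le> cauchy_density h 0 ((y - 0) / c)"
      using h by (simp add: cauchy_density_def)
    ultimately show ?thesis using c by (simp add: divide_ennreal)
  qed
  ultimately have "distr M lborel (\<lambda>\<omega>. c * Y \<omega>) = cauchy_law (\<bar>c\<bar> * h)"
    using c h by (simp add: distributed_def cauchy_law_def)
  moreover have "distr M borel (\<lambda>\<omega>. c * Y \<omega>) = distr M lborel (\<lambda>\<omega>. c * Y \<omega>)"
    by (rule distr_cong) auto
  ultimately show ?thesis by simp
qed

context cauchy_process
begin

lemma distr_increment:
  assumes "0 \<le> s" "s < t"
  shows "distr M borel (\<lambda>\<omega>. X t \<omega> - X s \<omega>) = cauchy_law (t - s)"
proof -
  have "distr M borel (\<lambda>\<omega>. X t \<omega> - X s \<omega>) = distr M lborel (\<lambda>\<omega>. X t \<omega> - X s \<omega>)"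
    by (rule distr_cong) auto
  also have "\<dots> = cauchy_law (t - s)"
    using increment_density[OF assms] assms by (simp add: distributed_def cauchy_law_def)
  finally show ?thesis .
qed

lemma prob_space_cauchy_law:
  assumes "0 \<le> t"
  shows "prob_space (cauchy_law t)"
proof (cases "t = 0")
  case True
  then show ?thesis by (simp add: cauchy_law_def prob_space_return)
next
  case False
  then show ?thesis
    using distr_increment[of 0 t] assms measurable_at[of 0] measurable_at[of t]
      prob_space_distr[of "\<lambda>\<omega>. X t \<omega> - X 0 \<omega>" borel] by simp
qed

lemma distr_scaled_increment:
  assumes s: "0 \<le> s" "s < t"
  shows "distr M borel (\<lambda>\<omega>. (X s \<omega> - X t \<omega>) / (t - s)) = cauchy_law 1"
proof -
  have "(\<lambda>\<omega>. (X s \<omega> - X t \<omega>) / (t - s)) = (\<lambda>\<omega>. (- 1 / (t - s)) * (X t \<omega> - X s \<omega>))"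
    using s by (auto simp: fun_eq_iff field_simps)
  then show ?thesis
    using distr_cauchy_scale[OF increment_density[OF s], of "- 1 / (t - s)"] s by simp
qed

lemma cauchy_law_of_nat:
  assumes "1 \<le> k"
  shows "cauchy_law (real k) = distr (cauchy_law 1) borel (\<lambda>s. real k * s)"
proof -
  have [measurable]: "X 1 \<in> borel_measurable M" "X 0 \<in> borel_measurable M"
    using measurable_at by auto
  have "distributed M lborel (\<lambda>\<omega>. X 1 \<omega> - X 0 \<omega>) (\<lambda>y. ennreal (cauchy_density 1 0 y))"
    using increment_density[of 0 1] by simp
  note scale = distr_cauchy_scale[OF this zero_less_one]
  have "distr (cauchy_law 1) borel (\<lambda>s. real k * s)
      = distr (distr M borel (\<lambda>\<omega>. X 1 \<omega> - X 0 \<omega>)) borel (\<lambda>s. real k * s)"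
    using distr_increment[of 0 1] by simp
  also have "\<dots> = distr M borel (\<lambda>\<omega>. real k * (X 1 \<omega> - X 0 \<omega>))"
    by (simp add: distr_distr comp_def)
  also have "\<dots> = cauchy_law (real k)" using scale[of "real k"] assms by simp
  finally show ?thesis ..
qed

text \<open>
  The convolution of two Cauchy laws is read off from the process itself: the increment over
  \<open>[0, k + 1]\<close> is the sum of the independent increments over \<open>[0, k]\<close> and \<open>[k, k + 1]\<close>.
\<close>
lemma cauchy_law_Suc:
  assumes "1 \<le> k"
  shows "cauchy_law (real (Suc k)) = distr (cauchy_law (real k) \<Otimes>\<^sub>M cauchy_law (real 1)) borel (\<lambda>(s, y). s + y)"
proof -
  define s where "s i = (if i = 0 then 0 else real k + (real i - 1))" for i :: nat
  have s: "s 0 = 0" "s 1 = real k" "s 2 = real (Suc k)" by (auto simp: s_def)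
  let ?Y = "\<lambda>i \<omega>. X (s (Suc i)) \<omega> - X (s i) \<omega>"
  have ind: "indep_vars (\<lambda>_. borel) ?Y {..<2}"
    by (rule indep_increments) (use assms in \<open>auto simp: s_def\<close>)
  have f: "(\<lambda>h. h i) \<in> borel_measurable (PiM {i} (\<lambda>_. borel))" for i :: nat
    by (auto intro!: measurable_component_singleton)
  have AB: "{0::nat} \<inter> {1} = {}" "{0} \<subseteq> {..<2::nat}" "{1} \<subseteq> {..<2::nat}" by auto
  have U: "?Y i \<omega> = (\<lambda>h. h i) (\<lambda>i\<in>{i}. ?Y i \<omega>)" for i :: nat and \<omega> by simp
  note pair = indep_vars_pair_distr[OF ind AB f f U U]
  note [measurable] = pair(2,3)
  have law: "distr M borel (?Y 0) = cauchy_law (real k)" "distr M borel (?Y 1) = cauchy_law (real 1)"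
    using distr_increment[of "s 0" "s 1"] distr_increment[of "s 1" "s 2"] assms
    by (simp_all add: s s(2)[simplified] flip: numeral_2_eq_2)
  have "cauchy_law (real (Suc k)) = distr M borel (\<lambda>\<omega>. X (s 2) \<omega> - X (s 0) \<omega>)"
    using distr_increment[of "s 0" "s 2"] by (simp add: s)
  also have "\<dots> = distr M borel (\<lambda>\<omega>. ?Y 0 \<omega> + ?Y 1 \<omega>)"
    by (simp add: numeral_2_eq_2)
  also have "\<dots> = distr (distr M (borel \<Otimes>\<^sub>M borel) (\<lambda>\<omega>. (?Y 0 \<omega>, ?Y 1 \<omega>))) borel (\<lambda>(s, y). s + y)"
    by (subst distr_distr[OF _ measurable_Pair[OF pair(2,3)]]) (simp_all add: comp_def)
  finally show ?thesis unfolding pair(1) law .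
qed

text \<open>
  The largest drop below the starting value on the grid of mesh \<open>T / n\<close>, in units of \<open>T\<close>. For
  \<open>n = 0\<close> the mesh is \<open>T / 0 = 0\<close> and the value is \<open>0\<close>.
\<close>
definition grid_max :: "real \<Rightarrow> nat \<Rightarrow> 'a \<Rightarrow> real" where
  "grid_max T n \<omega> = Max ((\<lambda>i. X 0 \<omega> - X (real i * (T / real n)) \<omega>) ` {..n}) / T"

text \<open>
  Dividing by the mesh turns the increments into independent standard Cauchy variables, so the law
  does not depend on \<open>T\<close>.
\<close>
lemma distr_grid_max:
  assumes T: "0 < T"
  shows "distr M borel (\<lambda>\<omega>. real n * grid_max T n \<omega>) = walk_max_law (cauchy_law 1) n"
proof (cases "n = 0")
  case True
  then show ?thesis by (simp add: distr_const)
next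
  case False
  then have n: "0 < real n" by simp
  define h where "h = T / real n"
  have h: "0 < h" using T n by (simp add: h_def)
  let ?Y = "\<lambda>i \<omega>. (X (real i * h) \<omega> - X (real (Suc i) * h) \<omega>) / h"
  have "indep_vars (\<lambda>_. borel) (\<lambda>i \<omega>. X (real (Suc i) * h) \<omega> - X (real i * h) \<omega>) {..<n}"
    by (rule indep_increments) (use h in auto)
  then have "indep_vars (\<lambda>_. borel) (\<lambda>i. (\<lambda>y. - y / h) \<circ> (\<lambda>\<omega>. X (real (Suc i) * h) \<omega> - X (real i * h) \<omega>)) {..<n}"
    by (rule indep_vars_compose) auto
  then have ind: "indep_vars (\<lambda>_. borel) ?Y {..<n}" by (simp only: comp_def minus_diff_eq)
  have law: "distr M borel (?Y i) = cauchy_law 1" for i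
    using distr_scaled_increment[of "real i * h" "real (Suc i) * h"] h by (simp add: algebra_simps)
  have "real n * grid_max T n \<omega> = walk_max n (\<lambda>i. ?Y (0 + i) \<omega>)" for \<omega>
  proof -
    have "walk_max n (\<lambda>i. ?Y (0 + i) \<omega>) = Max ((\<lambda>i. X 0 \<omega> / h - X (real i * h) \<omega> / h) ` {..n})"
      using walk_max_eq_Max[of n "\<lambda>i. X (real i * h) \<omega> / h"] by (simp add: diff_divide_distrib)
    also have "\<dots> = Max ((\<lambda>y. y / h) ` (\<lambda>i. X 0 \<omega> - X (real i * h) \<omega>) ` {..n})"
      by (simp add: image_image diff_divide_distrib)
    also have "\<dots> = Max ((\<lambda>i. X 0 \<omega> - X (real i * h) \<omega>) ` {..n}) / h"
      using h by (intro mono_Max_commute[symmetric] monoI) (auto simp: divide_right_mono)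
    also have "\<dots> = real n * grid_max T n \<omega>"
      unfolding grid_max_def h_def using n T by simp
    finally show ?thesis by simp
  qed
  then show ?thesis
    using distr_walk_max[OF ind law, of 0 n] by simp
qed

end

section \<open>The first exit time from the half-line\<close>

context cauchy_process
begin

text \<open>
  A limit over countably many grids is measurable with respect to \<open>M\<close>; on the almost
  sure event of cadlag paths it is the supremum of \<open>(X\<^sub>0 - X\<^sub>t) / T\<close> over \<open>[0, T]\<close>.
\<close>
definition scaled_sup :: "real \<Rightarrow> 'a \<Rightarrow> real" where
  "scaled_sup T \<omega> = lim (\<lambda>n. grid_max T n \<omega>)"

lemma grid_max_measurable [measurable]:
  assumes "0 < T"
  shows "grid_max T n \<in> borel_measurable M"
proof -
  have "(\<lambda>\<omega>. X 0 \<omega> - X (real i * (T / real n)) \<omega>) \<in> borel_measurable M" for i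
    using assms by (intro borel_measurable_diff measurable_at) auto
  then show ?thesis unfolding grid_max_def by (intro borel_measurable_divide borel_measurable_Max) auto
qed

lemma scaled_sup_measurable [measurable]: "0 < T \<Longrightarrow> scaled_sup T \<in> borel_measurable M"
  unfolding scaled_sup_def by (intro borel_measurable_lim_metric grid_max_measurable)

lemma grid_max_tendsto:
  assumes \<omega>: "cadlag (\<lambda>t. X t \<omega>)" and T: "0 < T"
  shows "(\<lambda>n. grid_max T n \<omega>) \<longlonglongrightarrow> scaled_sup T \<omega>"
    and "scaled_sup T \<omega> = (SUP t\<in>{0..T}. X 0 \<omega> - X t \<omega>) / T"
    and "0 \<le> scaled_sup T \<omega>"
proof -
  have lim: "(\<lambda>n. grid_max T n \<omega>) \<longlonglongrightarrow> (SUP t\<in>{0..T}. X 0 \<omega> - X t \<omega>) / T"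
    unfolding grid_max_def using T by (intro tendsto_divide tendsto_const cadlag_grid_Max_tendsto(1)[OF \<omega> T]) simp
  then show eq: "scaled_sup T \<omega> = (SUP t\<in>{0..T}. X 0 \<omega> - X t \<omega>) / T"
    unfolding scaled_sup_def by (rule limI)
  from lim show "(\<lambda>n. grid_max T n \<omega>) \<longlonglongrightarrow> scaled_sup T \<omega>" unfolding eq .
  have "X 0 \<omega> - X 0 \<omega> \<le> (SUP t\<in>{0..T}. X 0 \<omega> - X t \<omega>)"
    by (rule cSUP_upper[OF _ cadlag_grid_Max_tendsto(2)[OF \<omega> T]]) (use T in simp)
  then show "0 \<le> scaled_sup T \<omega>" unfolding eq using T by simp
qed

lemma cauchy_max_law_scaled_sup:
  assumes T: "0 < T"
  shows "cauchy_max_law (distr M borel (scaled_sup T))"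
proof -
  note [measurable] = scaled_sup_measurable[OF T]
  have Z0: "AE \<omega> in M. 0 \<le> scaled_sup T \<omega>"
    using cadlag_paths by eventually_elim (rule grid_max_tendsto(3)[OF _ T])
  have ode: "(\<integral>v. 1 / (p + v)\<^sup>2 \<partial>distr M borel (scaled_sup T))
      = (1 / (2 * p) + (p / 2 - ln p / pi) / (1 + p\<^sup>2)) * (\<integral>v. 1 / (p + v) \<partial>distr M borel (scaled_sup T))"
    if p: "0 < p" for p
  proof -
    let ?\<beta> = "1 / (2 * p) + half_cauchy_stieltjes p / pi"
    have "(\<integral>\<^sup>+\<omega>. ennreal (1 / (p + scaled_sup T \<omega>)\<^sup>2) \<partial>M)
      = (\<integral>\<^sup>+s. ennreal (1 / (p + max 0 s)) \<partial>cauchy_law (real 1)) * (\<integral>\<^sup>+\<omega>. ennreal (1 / (p + scaled_sup T \<omega>)) \<partial>M)"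
    proof (rule stable_walk_limit_identity[where F="\<lambda>k. cauchy_law (real k)" and Zn="grid_max T"])
      show "AE \<omega> in M. (\<lambda>n. grid_max T n \<omega>) \<longlonglongrightarrow> scaled_sup T \<omega>"
        using cadlag_paths by eventually_elim (rule grid_max_tendsto(1)[OF _ T])
      show "distr M borel (\<lambda>\<omega>. real n * grid_max T n \<omega>) = walk_max_law (cauchy_law (real 1)) n" for n
        using distr_grid_max[OF T] by simp
      show "cauchy_law (real k) = distr (cauchy_law (real 1)) borel (\<lambda>s. real k * s)" if "1 \<le> k" for k
        using cauchy_law_of_nat[OF that] by simp
      show "cauchy_law (real (Suc k)) = distr (cauchy_law (real k) \<Otimes>\<^sub>M cauchy_law (real 1)) borel (\<lambda>(s, y). s + y)"
        if "1 \<le> k" for k by (rule cauchy_law_Suc[OF that])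
    qed (use Z0 p T prob_space_axioms in \<open>auto intro: prob_space_cauchy_law\<close>)
    then have nn: "(\<integral>\<^sup>+\<omega>. ennreal (1 / (p + scaled_sup T \<omega>)\<^sup>2) \<partial>M) = ennreal ?\<beta> * (\<integral>\<^sup>+\<omega>. ennreal (1 / (p + scaled_sup T \<omega>)) \<partial>M)"
      using nn_integral_cauchy_positive_part[OF p] by simp
    have "(\<integral>v. 1 / (p + v)\<^sup>2 \<partial>distr M borel (scaled_sup T)) = (\<integral>\<omega>. 1 / (p + scaled_sup T \<omega>)\<^sup>2 \<partial>M)"
      by (rule integral_distr) measurable
    also have "\<dots> = enn2real (\<integral>\<^sup>+\<omega>. ennreal (1 / (p + scaled_sup T \<omega>)\<^sup>2) \<partial>M)"
      by (rule integral_eq_nn_integral) auto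
    also have "\<dots> = ?\<beta> * enn2real (\<integral>\<^sup>+\<omega>. ennreal (1 / (p + scaled_sup T \<omega>)) \<partial>M)"
    proof -
      have "0 \<le> ?\<beta>" using p half_cauchy_stieltjes_nonneg[OF p] by simp
      then show ?thesis unfolding nn enn2real_mult by (simp only: enn2real_ennreal)
    qed
    also have "enn2real (\<integral>\<^sup>+\<omega>. ennreal (1 / (p + scaled_sup T \<omega>)) \<partial>M) = (\<integral>\<omega>. 1 / (p + scaled_sup T \<omega>) \<partial>M)"
      by (rule integral_eq_nn_integral[symmetric]) (use Z0 p in \<open>auto elim!: eventually_mono\<close>)
    also have "\<dots> = (\<integral>v. 1 / (p + v) \<partial>distr M borel (scaled_sup T))"
      by (rule integral_distr[symmetric]) measurable
    also have "half_cauchy_stieltjes p / pi = (p / 2 - ln p / pi) / (1 + p\<^sup>2)"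
      by (simp add: half_cauchy_stieltjes_def diff_divide_distrib)
    finally show ?thesis .
  qed
  show ?thesis
    unfolding cauchy_max_law_def nonneg_law_def nonneg_law_axioms_def cauchy_max_law_axioms_def
    using ode Z0 by (auto simp: AE_distr_iff intro!: prob_space_distr)
qed

text \<open>
  The case that \<open>exit_time_le_sup\<close> leaves open is a null event, because the law of the supremum has no
  atom at \<open>x / T\<close>.
\<close>
lemma exit_time_AE:
  assumes x: "0 < x" and T: "0 < T"
  shows "AE \<omega> in M. x / T \<le> scaled_sup T \<omega> \<longleftrightarrow> exit_time X {0<..} \<omega> \<le> ereal T"
proof -
  note [measurable] = scaled_sup_measurable[OF T]
  interpret Z: cauchy_max_law "distr M borel (scaled_sup T)" by (rule cauchy_max_law_scaled_sup[OF T])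
  have "AE v in distr M borel (scaled_sup T). v \<noteq> x / T"
    using Z.emeasure_singleton[of "x / T"] x T by (intro AE_I[where N="{x / T}"]) auto
  then have "AE \<omega> in M. scaled_sup T \<omega> \<noteq> x / T" by (simp add: AE_distr_iff)
  then show ?thesis using cadlag_paths start
  proof eventually_elim
    case (elim \<omega>)
    let ?S = "SUP t\<in>{0..T}. X 0 \<omega> - X t \<omega>"
    have sup: "scaled_sup T \<omega> = ?S / T" by (rule grid_max_tendsto(2)[OF elim(2) T])
    have le: "x / T \<le> scaled_sup T \<omega> \<longleftrightarrow> x \<le> ?S" unfolding sup using T by (simp add: divide_le_cancel)
    have "?S \<noteq> x" using elim(1) sup by auto
    then show ?case
      using exit_time_le_sup[where X=X and \<omega>=\<omega>, OF elim(2) T] elim(3) le by auto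
  qed
qed

lemma exit_time_pos_AE:
  assumes x: "0 < x"
  shows "AE \<omega> in M. 0 < exit_time X {0<..} \<omega>"
  using cadlag_paths start
proof eventually_elim
  case (elim \<omega>)
  then show ?case using exit_time_gt[of X \<omega> 0] x by (force simp: zero_ereal_def)
qed

end

lemma exit_time_nonneg: "0 \<le> exit_time X D \<omega>"
  unfolding exit_time_def by (rule INF_greatest) auto

theorem theorem5:
  fixes M :: "'a measure" and x :: real and X :: "real \<Rightarrow> 'a \<Rightarrow> real"
  assumes "x > 0"
    and "cauchy_process M x X"
  shows "exit_time X {0<..} \<in> borel_measurable (completion M) \<and>
    (\<forall>A \<in> sets borel. A \<subseteq> {0<..} \<longrightarrow>
       emeasure (completion M) {\<omega> \<in> space M. exit_time X {0<..} \<omega> \<in> ereal ` A} =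
       (\<integral>\<^sup>+t\<in>A. ennreal (1 / pi * (x / (t\<^sup>2 + x\<^sup>2)) *
          exp (1 / pi * (LBINT w:{0<..}. ln (t / x + w) / (1 + w\<^sup>2)))) \<partial>lborel))"
proof -
  interpret cauchy_process M x X by (rule assms(2))
  note x = \<open>x > 0\<close>
  let ?\<tau> = "exit_time X {0<..}"
  define h where "h t = ennreal (1 / pi * (x / (t\<^sup>2 + x\<^sup>2)) * exp (1 / pi * log_potential (t / x)))" for t
  have [measurable]: "h \<in> borel_measurable borel" unfolding h_def log_potential_def set_lebesgue_integral_def by measurable
  define E where "E T = {\<omega> \<in> space M. x / T \<le> scaled_sup T \<omega>}" for T
  have E_sets: "E T \<in> sets M" if "0 < T" for T
    using scaled_sup_measurable[OF that] unfolding E_def by measurable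
  have E_AE: "AE \<omega> in completion M. \<omega> \<in> E T \<longleftrightarrow> \<omega> \<in> {\<omega> \<in> space M. ?\<tau> \<omega> \<le> ereal T}" if "0 < T" for T
    using exit_time_AE[OF x that] by (intro AE_completion) (auto simp: E_def elim!: eventually_mono)
  have pos_AE: "AE \<omega> in completion M. 0 < ?\<tau> \<omega>"
    by (rule AE_completion[OF exit_time_pos_AE[OF x]])
  have le_sets: "{\<omega> \<in> space M. ?\<tau> \<omega> \<le> y} \<in> sets (completion M)" for y
  proof (cases y)
    case (real r)
    show ?thesis
    proof (cases "0 < r")
      case True
      show ?thesis unfolding real
        by (rule completion.in_sets_AE[OF E_AE[OF True]]) (use E_sets[OF True] in auto)
    next
      case False
      show ?thesis
      proof (rule completion.in_sets_AE[where A="{}"])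
        show "AE \<omega> in completion M. \<omega> \<in> {} \<longleftrightarrow> \<omega> \<in> {\<omega> \<in> space M. ?\<tau> \<omega> \<le> y}"
          using pos_AE
        proof eventually_elim
          case (elim \<omega>)
          have "y \<le> 0" using False real by simp
          with elim show ?case by auto
        qed
      qed auto
    qed
  next
    case PInf
    then show ?thesis using sets.top[of "completion M"] by simp
  next
    case MInf
    have "\<not> ?\<tau> \<omega> \<le> y" for \<omega> using exit_time_nonneg[of X "{0<..}" \<omega>] MInf by auto
    then show ?thesis by simp
  qed
  then have meas: "?\<tau> \<in> borel_measurable (completion M)"
    by (intro borel_measurableI_le) simp
  have cdf: "emeasure (completion M) {\<omega> \<in> space M. ?\<tau> \<omega> \<le> ereal T} = (\<integral>\<^sup>+t. h t * indicator {0<..T} t \<partial>lborel)"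
    if T: "0 < T" for T
  proof -
    interpret Z: cauchy_max_law "distr M borel (scaled_sup T)" by (rule cauchy_max_law_scaled_sup[OF T])
    have "emeasure (completion M) {\<omega> \<in> space M. ?\<tau> \<omega> \<le> ereal T} = emeasure (completion M) (E T)"
      using E_AE[OF T] E_sets[OF T] le_sets by (intro emeasure_eq_AE) auto
    also have "\<dots> = emeasure M (E T)" using E_sets[OF T] by simp
    also have "\<dots> = emeasure (distr M borel (scaled_sup T)) {x / T..}"
      using scaled_sup_measurable[OF T] by (subst emeasure_distr) (auto simp: E_def intro!: arg_cong[of _ _ "emeasure M"])
    also have "\<dots> = (\<integral>\<^sup>+t. h t * indicator {0<..T} t \<partial>lborel)"
      unfolding h_def by (rule Z.emeasure_tail[OF x T])
    finally show ?thesis .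
  qed
  (* real_of_ereal sends \<infinity> to 0, so R is positive exactly where the exit time is positive and
     finite, and restricting the law of R to {0<..} discards the paths that never leave. *)
  define R where "R \<omega> = real_of_ereal (?\<tau> \<omega>)" for \<omega>
  have R_meas [measurable]: "R \<in> borel_measurable (completion M)"
    using meas unfolding R_def by measurable
  define \<mu> where "\<mu> = density (distr (completion M) borel R) (indicator {0<..})"
  define \<nu> where "\<nu> = density lborel (\<lambda>t. h t * indicator {0<..} t)"
  have mu: "emeasure \<mu> B = emeasure (completion M) {\<omega> \<in> space M. R \<omega> \<in> {0<..} \<inter> B}" if [measurable]: "B \<in> sets borel" for B
    unfolding \<mu>_def by (subst emeasure_restricted) (auto simp: emeasure_distr intro!: arg_cong[of _ _ "emeasure (completion M)"])
  have nu: "emeasure \<nu> B = (\<integral>\<^sup>+t. h t * indicator ({0<..} \<inter> B) t \<partial>lborel)" if "B \<in> sets borel" for B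
    unfolding \<nu>_def using that
    by (subst emeasure_density) (auto intro!: nn_integral_cong simp: indicator_inter_arith mult.assoc)
  have Iic: "emeasure \<mu> {..c} = emeasure \<nu> {..c}" for c
  proof (cases "0 < c")
    case True
    have "emeasure \<mu> {..c} = emeasure (completion M) {\<omega> \<in> space M. ?\<tau> \<omega> \<le> ereal c}"
      unfolding mu[OF atMost_borel]
    proof (rule emeasure_eq_AE)
      show "AE \<omega> in completion M. \<omega> \<in> {\<omega> \<in> space M. R \<omega> \<in> {0<..} \<inter> {..c}} \<longleftrightarrow> \<omega> \<in> {\<omega> \<in> space M. ?\<tau> \<omega> \<le> ereal c}"
        using pos_AE
      proof eventually_elim
        case (elim \<omega>)
        then show ?case by (cases "?\<tau> \<omega>") (auto simp: R_def)
      qed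
      have "{\<omega> \<in> space (completion M). R \<omega> \<in> {0<..} \<inter> {..c}} \<in> sets (completion M)" by measurable
      then show "{\<omega> \<in> space M. R \<omega> \<in> {0<..} \<inter> {..c}} \<in> sets (completion M)" by simp
    qed (rule le_sets)
    also have "\<dots> = emeasure \<nu> {..c}"
    proof -
      have "{0<..} \<inter> {..c} = {0<..c}" by auto
      then show ?thesis unfolding cdf[OF True] nu[OF atMost_borel] by simp
    qed
    finally show ?thesis .
  next
    case False
    then have "{0<..} \<inter> {..c} = {}" by auto
    then show ?thesis unfolding mu[OF atMost_borel] nu[OF atMost_borel] by simp
  qed
  have "\<mu> = \<nu>"
  proof (rule measure_eqI_generator_eq[where E="range (\<lambda>c. {..c})" and \<Omega>=UNIV and A="\<lambda>n. {..real n}"])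
    show "Int_stable (range (\<lambda>c::real. {..c}))"
      by (auto simp: Int_stable_def)
    show "emeasure \<mu> Y = emeasure \<nu> Y" if "Y \<in> range (\<lambda>c. {..c})" for Y
      using that Iic by auto
    show "sets \<mu> = sigma_sets UNIV (range (\<lambda>c. {..c}))" "sets \<nu> = sigma_sets UNIV (range (\<lambda>c. {..c}))"
      unfolding \<mu>_def \<nu>_def by (simp_all add: borel_eq_atMost)
    show "(\<Union>n. {..real n}) = UNIV" using real_arch_simple by auto
    show "emeasure \<mu> {..real n} \<noteq> \<infinity>" for n
    proof -
      have "emeasure (completion M) S \<le> 1" for S
        using prob_space.emeasure_le_1[OF prob_space_completion] by blast
      then show ?thesis unfolding mu[OF atMost_borel] by (metis ennreal_one_neq_top infinity_ennreal_def neq_top_trans)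
    qed
  qed auto
  have "emeasure (completion M) {\<omega> \<in> space M. ?\<tau> \<omega> \<in> ereal ` A} = (\<integral>\<^sup>+t. h t * indicator A t \<partial>lborel)"
    if A: "A \<in> sets borel" "A \<subseteq> {0<..}" for A
  proof -
    have "?\<tau> \<omega> \<in> ereal ` A \<longleftrightarrow> R \<omega> \<in> {0<..} \<inter> A" for \<omega>
      using A(2) by (cases "?\<tau> \<omega>") (auto simp: R_def)
    then have "emeasure (completion M) {\<omega> \<in> space M. ?\<tau> \<omega> \<in> ereal ` A} = emeasure \<mu> A"
      unfolding mu[OF A(1)] by simp
    also have "\<dots> = emeasure \<nu> A" unfolding \<open>\<mu> = \<nu>\<close> ..
    also have "\<dots> = (\<integral>\<^sup>+t. h t * indicator A t \<partial>lborel)"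
      unfolding nu[OF A(1)] using A(2) by (simp add: Int_absorb1)
    finally show ?thesis .
  qed
  with meas show ?thesis unfolding h_def log_potential_def by blast
qed

end
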